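(* Let $k\ge2$, $q\ge1$ and let $F$ be a $(t-1)$-dimensional face of $T_{k,q}$. Then there are posets $P_1,\ldots,P_t$, each a product of finitely many chains, such that $\mathrm{link}_{T_{k,q}}(F)\cong\Delta(\overline{P}_1)*\Delta(\overline{P}_2)*\cdots*\Delta(\overline{P}_t)$, where $\overline{P}_i$ is $P_i$ with its minimum and maximum removed.
   Context: $R_{k,q}=\{\mathbf{x}\in\mathbb{R}^{k-1}:0\le x_1\le\cdots\le x_{k-1}\le q\}$, $W_{k,q}=R_{k,q}\cap\mathbb{Z}^{k-1}$. A permutation $\pi$ of $[k-1]$ is consistent with $\mathbf{v}\in W_{k,q}$ if $i$ precedes $i+1$ in $\pi$ whenever $v_i=v_{i+1}$; then $F(\mathbf{v},\pi)$ is the simplex with vertices $\mathbf{v}^{(1)}=\mathbf{v}$, $\mathbf{v}^{(m+1)}=\mathbf{v}^{(m)}+e_{\pi_{k-m}}$ ($m=1,\dots,k-1$). $T_{k,q}$ is the simplicial complex on $W_{k,q}$ whose facets are all such $F(\mathbf{v},\pi)$; $\mathrm{link}_K(\sigma)=\{\tau\in K:\sigma\cup\tau\in K,\sigma\cap\tau=\emptyset\}$. A chain here is $C_m=\{0<1<\cdots<m\}$, $m\ge1$; products carry the componentwise order. $\Delta(P)$ is the order complex of $P$ (the order complex of the empty poset is the complex $\{\emptyset\}$), and $*$ denotes the join of simplicial complexes. *)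

theory Defs
  imports Complex_Main "HOL-Library.FuncSet" "HOL-Combinatorics.Permutations"
begin

text \<open>A complex is the set of its faces, the empty face included; its vertex set is its union.\<close>

definition link :: "'a set set \<Rightarrow> 'a set \<Rightarrow> 'a set set" where
  "link K \<sigma> = {\<tau> \<in> K. \<sigma> \<union> \<tau> \<in> K \<and> \<sigma> \<inter> \<tau> = {}}"

definition complex_iso :: "'a set set \<Rightarrow> 'b set set \<Rightarrow> bool" (infix "\<cong>\<^sub>c" 50) where
  "K \<cong>\<^sub>c L \<longleftrightarrow> (\<exists>f. bij_betw f (\<Union>K) (\<Union>L) \<and> (\<lambda>\<sigma>. f ` \<sigma>) ` K = L)"

text \<open>Vertices are tagged with the index of their factor, so the factors become vertex-disjoint.\<close>

definition complex_join :: "'a set set list \<Rightarrow> (nat \<times> 'a) set set" where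
  "complex_join Ks =
     {(\<Union>i<length Ks. Pair i ` \<sigma> i) | \<sigma>. \<forall>i<length Ks. \<sigma> i \<in> Ks ! i}"

text \<open>A poset is given by its reflexive order relation \<open>r\<close>; its underlying set is \<open>Field r\<close>.\<close>

definition order_complex :: "'a rel \<Rightarrow> 'a set set" where
  "order_complex r = {\<sigma> \<in> Chains r. finite \<sigma>}"

definition proper_part :: "'a rel \<Rightarrow> 'a rel" where
  "proper_part r = Restr r {x \<in> Field r.
     \<not> (\<forall>y \<in> Field r. (x, y) \<in> r) \<and> \<not> (\<forall>y \<in> Field r. (y, x) \<in> r)}"

definition chain_poset :: "nat \<Rightarrow> nat rel" where
  "chain_poset m = {(i, j). i \<le> j \<and> j \<le> m}"

definition prod_poset :: "'a rel list \<Rightarrow> 'a list rel" where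
  "prod_poset rs = {(xs, ys). length xs = length rs \<and> length ys = length rs \<and>
     (\<forall>i<length rs. (xs ! i, ys ! i) \<in> rs ! i)}"

definition product_of_chains :: "nat list rel \<Rightarrow> bool" where
  "product_of_chains P \<longleftrightarrow>
     (\<exists>ms. ms \<noteq> [] \<and> (\<forall>m \<in> set ms. m \<ge> 1) \<and> P = prod_poset (map chain_poset ms))"

text \<open>Vectors in $\mathbb{R}^{k-1}$ are extensional functions on \<open>{1..k-1}\<close>.\<close>

definition R :: "nat \<Rightarrow> nat \<Rightarrow> (nat \<Rightarrow> real) set" where
  "R k q = {x \<in> {1..k-1} \<rightarrow>\<^sub>E {0..real q}. mono_on {1..k-1} x}"

definition W :: "nat \<Rightarrow> nat \<Rightarrow> (nat \<Rightarrow> real) set" where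
  "W k q = R k q \<inter> ({1..k-1} \<rightarrow>\<^sub>E \<int>)"

text \<open>A permutation \<open>\<pi>\<close> stands for the word \<open>\<pi> 1, \<dots>, \<pi> (k-1)\<close>, so \<open>inv \<pi> i\<close> is the position of \<open>i\<close>.\<close>

definition consistent :: "nat \<Rightarrow> (nat \<Rightarrow> nat) \<Rightarrow> (nat \<Rightarrow> real) \<Rightarrow> bool" where
  "consistent k \<pi> v \<longleftrightarrow>
     (\<forall>i. 1 \<le> i \<and> i + 1 \<le> k - 1 \<and> v i = v (i + 1) \<longrightarrow> inv \<pi> i < inv \<pi> (i + 1))"

definition add_unit :: "nat \<Rightarrow> (nat \<Rightarrow> real) \<Rightarrow> nat \<Rightarrow> real" where
  "add_unit i v = v(i := v i + 1)"

text \<open>The superscripts are shifted by one: \<open>simplex_vertex k v \<pi> j\<close> is $\mathbf{v}^{(j+1)}$.\<close>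

primrec simplex_vertex ::
  "nat \<Rightarrow> (nat \<Rightarrow> real) \<Rightarrow> (nat \<Rightarrow> nat) \<Rightarrow> nat \<Rightarrow> nat \<Rightarrow> real" where
  "simplex_vertex k v \<pi> 0 = v"
| "simplex_vertex k v \<pi> (Suc j) = add_unit (\<pi> (k - Suc j)) (simplex_vertex k v \<pi> j)"

definition simplex_F :: "nat \<Rightarrow> (nat \<Rightarrow> real) \<Rightarrow> (nat \<Rightarrow> nat) \<Rightarrow> (nat \<Rightarrow> real) set" where
  "simplex_F k v \<pi> = simplex_vertex k v \<pi> ` {0..k-1}"

text \<open>The last vertex of \<open>simplex_F k v \<pi>\<close> is \<open>v\<close> plus the all-ones vector, which leaves \<open>W k q\<close> if
  \<open>v (k-1) = q\<close>. As the complex has vertex set \<open>W k q\<close>, only simplices inside \<open>W k q\<close> are facets.\<close>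

definition T_facets :: "nat \<Rightarrow> nat \<Rightarrow> (nat \<Rightarrow> real) set set" where
  "T_facets k q = {simplex_F k v \<pi> | v \<pi>.
     v \<in> W k q \<and> \<pi> permutes {1..k-1} \<and> consistent k \<pi> v \<and> simplex_F k v \<pi> \<subseteq> W k q}"

definition T :: "nat \<Rightarrow> nat \<Rightarrow> (nat \<Rightarrow> real) set set" where
  "T k q = {\<sigma>. \<exists>\<phi> \<in> T_facets k q. \<sigma> \<subseteq> \<phi>}"

end

(* The conjugate of a point w of W k q is the function counting, for each c, the coordinates that
   are at most c; extended by g (c + q) = g c + k it becomes a monotone function on the integers.
   Conjugation turns x <= y <= x + 1 into g_y <= g_x <= shift g_y, where (shift g) c = g (c + 1), so
   a nonempty face F becomes a chain v_0 < ... < v_(t-1) < v_t = shift v_0, and the link of F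
   consists of what lies between consecutive v_i, points being taken up to shift. The values
   at c = 0, ..., q - 1 of a function between v_i and v_(i+1) <= shift v_i can be chosen
   independently, hence each such interval is a product of chains. *)

theory Submission
  imports Defs
begin

section \<open>Faces of the triangulation\<close>

text \<open>The starting point is that \<open>T k q\<close> is a flag complex: by
  \<open>mem_T_iff\<close> a nonempty subset of \<open>W k q\<close> is a face as soon as any two of
  its points satisfy x \<le> y \<le> x + 1 in one of the two orders. Permutations and facets are
  needed only to prove this; afterwards the link is the flag complex of a relation between points.
  The relation x \<le> y \<le> x + 1 is not transitive, so it is not itself an order whose intervals
  could be used: it goes around a cycle. On the conjugate side the cycle is the action of shift.
  Each orbit contains exactly one function with g (-1) < 0 \<le> g 0, and these functions are the
  conjugates of the points of \<open>W k q\<close>. Fixing a vertex of the face with conjugate v_0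
  cuts the cycle open: every point of the link has exactly one lift, its conjugate or the shift of
  it, between v_0 and shift v_0, and there two points are near exactly when their lifts are
  comparable. Order complexes and their joins are flag complexes too, so it is enough to match
  vertices and pairs.\<close>

definition below_within_one :: "nat \<Rightarrow> (nat \<Rightarrow> real) \<Rightarrow> (nat \<Rightarrow> real) \<Rightarrow> bool" where
  "below_within_one k x y \<longleftrightarrow> (\<forall>i\<in>{1..k-1}. x i \<le> y i \<and> y i \<le> x i + 1)"

lemma W_memD:
  assumes "x \<in> W k q"
  shows "i \<in> {1..k-1} \<Longrightarrow> 0 \<le> x i" "i \<in> {1..k-1} \<Longrightarrow> x i \<le> real q"
    "i \<in> {1..k-1} \<Longrightarrow> x i \<in> \<int>" "\<lbrakk>1 \<le> i; i \<le> j; j \<le> k-1\<rbrakk> \<Longrightarrow> x i \<le> x j"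
    "x \<in> extensional {1..k-1}"
  using assms by (auto simp: W_def R_def PiE_def Pi_def mono_on_def)

lemma W_memI:
  assumes "x \<in> extensional {1..k-1}" "\<And>i. i \<in> {1..k-1} \<Longrightarrow> 0 \<le> x i \<and> x i \<le> real q \<and> x i \<in> \<int>"
    "\<And>i j. \<lbrakk>1 \<le> i; i \<le> j; j \<le> k-1\<rbrakk> \<Longrightarrow> x i \<le> x j"
  shows "x \<in> W k q"
  using assms by (auto simp: W_def R_def PiE_def Pi_def mono_on_def)

lemma W_eqI:
  assumes "x \<in> W k q" "y \<in> W k q" "\<And>i. i \<in> {1..k-1} \<Longrightarrow> x i = y i"
  shows "x = y"
  using assms W_memD(5) extensionalityI by metis

lemma finite_W: "finite (W k q)"
proof -
  have "W k q \<subseteq> {1..k-1} \<rightarrow>\<^sub>E real ` {0..q}"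
  proof
    fix x assume x: "x \<in> W k q"
    have "x i \<in> real ` {0..q}" if i: "i \<in> {1..k-1}" for i
    proof -
      have "x i \<in> \<nat>" using W_memD(1,3)[OF x i] by (simp add: Nats_altdef2)
      then obtain n where n: "x i = real n" by (auto elim: Nats_cases)
      then show ?thesis using W_memD(2)[OF x i] by auto
    qed
    then show "x \<in> {1..k-1} \<rightarrow>\<^sub>E real ` {0..q}" using W_memD(5)[OF x] by (auto simp: PiE_def)
  qed
  then show ?thesis by (rule finite_subset) (auto intro: finite_PiE)
qed

lemma permutes_mem_image_iff:
  assumes "\<pi> permutes S"
  shows "i \<in> \<pi> ` A \<longleftrightarrow> inv \<pi> i \<in> A"
  using inj_image_mem_iff[OF permutes_inj[OF assms], of "inv \<pi> i" A]
  by (simp add: permutes_inverses[OF assms])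

text \<open>The word \<open>\<pi>\<close> is read from its last letter backwards, and injectivity
  keeps a coordinate from being raised twice. So a vertex is \<open>v\<close> plus the indicator of
  a final segment of the word.\<close>

lemma simplex_vertex_eq:
  assumes "k \<ge> 1" "\<pi> permutes {1..k-1}" "j \<le> k-1"
  shows "simplex_vertex k v \<pi> j = (\<lambda>i. v i + of_bool (i \<in> \<pi> ` {k-j..k-1}))"
  using assms(3)
proof (induction j)
  case 0
  then show ?case using assms(1) by auto
next
  case (Suc j)
  have ins: "{k - Suc j..k-1} = insert (k - Suc j) {k-j..k-1}" using Suc.prems by auto
  have "\<pi> (k - Suc j) \<notin> \<pi> ` {k-j..k-1}"
    using Suc.prems by (simp add: inj_image_mem_iff[OF permutes_inj[OF assms(2)]])
  then show ?case using Suc unfolding ins by (simp add: add_unit_def fun_eq_iff)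
qed

text \<open>Final segments of one word are nested, so their indicators are comparable and differ by
  at most 1.\<close>

lemma facet_pairwise:
  assumes "k \<ge> 1" "\<pi> permutes {1..k-1}" "x \<in> simplex_F k v \<pi>" "y \<in> simplex_F k v \<pi>"
  shows "below_within_one k x y \<or> below_within_one k y x"
proof -
  obtain a b where ab: "a \<le> k-1" "b \<le> k-1" "x = simplex_vertex k v \<pi> a" "y = simplex_vertex k v \<pi> b"
    using assms by (auto simp: simplex_F_def)
  have *: "below_within_one k (simplex_vertex k v \<pi> a) (simplex_vertex k v \<pi> b)" if "a \<le> b" "b \<le> k-1" for a b
  proof -
    have "\<pi> ` {k-a..k-1} \<subseteq> \<pi> ` {k-b..k-1}" using that by (intro image_mono) auto
    then show ?thesis using that
      by (auto simp: below_within_one_def simplex_vertex_eq[OF assms(1,2)])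
  qed
  show ?thesis unfolding ab(3,4) using *[of a b] *[of b a] ab(1,2) nat_le_linear[of a b] by blast
qed

text \<open>Here \<open>\<rho> i\<close> is the position of \<open>i\<close> when {1..n} is sorted
  by \<open>key\<close>; this makes a permutation out of a sorting criterion.\<close>

lemma rank_permutes:
  fixes key :: "nat \<Rightarrow> nat"
  assumes "inj_on key {1..n}"
  defines "\<rho> \<equiv> \<lambda>i. if i \<in> {1..n} then card {j \<in> {1..n}. key j \<le> key i} else i"
  shows "\<rho> permutes {1..n}"
proof (rule bij_imp_permutes)
  have less: "\<rho> i < \<rho> j" if "i \<in> {1..n}" "j \<in> {1..n}" "key i < key j" for i j
  proof -
    have "{l \<in> {1..n}. key l \<le> key i} \<subset> {l \<in> {1..n}. key l \<le> key j}"
    proof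
      show "{l \<in> {1..n}. key l \<le> key i} \<subseteq> {l \<in> {1..n}. key l \<le> key j}" using that by auto
      show "{l \<in> {1..n}. key l \<le> key i} \<noteq> {l \<in> {1..n}. key l \<le> key j}"
        using that by (metis (mono_tags, lifting) mem_Collect_eq leD order_refl)
    qed
    then have "card {l \<in> {1..n}. key l \<le> key i} < card {l \<in> {1..n}. key l \<le> key j}"
      by (intro psubset_card_mono) auto
    then show ?thesis using that by (simp add: \<rho>_def)
  qed
  have "inj_on \<rho> {1..n}"
  proof (rule inj_onI)
    fix i j assume ij: "i \<in> {1..n}" "j \<in> {1..n}" "\<rho> i = \<rho> j"
    then have "key i = key j" using less[of i j] less[of j i] by (cases "key i" "key j" rule: linorder_cases) auto
    then show "i = j" using assms(1) ij by (auto dest: inj_onD)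
  qed
  moreover have "\<rho> ` {1..n} \<subseteq> {1..n}"
  proof
    fix a assume "a \<in> \<rho> ` {1..n}"
    then obtain i where i: "i \<in> {1..n}" "a = \<rho> i" by auto
    have "card {j \<in> {1..n}. key j \<le> key i} \<le> card {1..n}" by (rule card_mono) auto
    moreover have "card {j \<in> {1..n}. key j \<le> key i} > 0" using i by (auto simp: card_gt_0_iff)
    ultimately show "a \<in> {1..n}" using i by (auto simp: \<rho>_def)
  qed
  ultimately show "bij_betw \<rho> {1..n} {1..n}"
    by (simp add: bij_betw_def endo_inj_surj)
qed (auto simp: \<rho>_def)

text \<open>Sort the coordinates by how many vertices have already incremented them, ties by index: the
  increment sets of the vertices are nested, so each of them is a final segment of this order.\<close>

lemma between_imp_subset_facet:
  assumes k: "k \<ge> 1" and v: "v \<in> W k q" and fin: "finite \<sigma>" and \<sigma>W: "\<sigma> \<subseteq> W k q"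
    and bet: "\<And>x. x \<in> \<sigma> \<Longrightarrow> below_within_one k v x"
    and pair: "\<And>x y. \<lbrakk>x \<in> \<sigma>; y \<in> \<sigma>\<rbrakk> \<Longrightarrow> below_within_one k x y \<or> below_within_one k y x"
  obtains \<pi> where "\<pi> permutes {1..k-1}" "consistent k \<pi> v" "\<sigma> \<subseteq> simplex_F k v \<pi>"
proof -
  define S where "S x = {i \<in> {1..k-1}. x i = v i + 1}" for x
  define N where "N i = card {x \<in> \<sigma>. i \<in> S x}" for i
  \<comment> \<open>The lexicographic order on the pairs (\<open>N i\<close>, \<open>i\<close>) as
    one number: the indices in {1..k-1} are below \<open>k\<close>.\<close>
  define key where "key i = N i * k + i" for i
  define \<rho> where "\<rho> = (\<lambda>i. if i \<in> {1..k-1} then card {j \<in> {1..k-1}. key j \<le> key i} else i)"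
  have key_less: "key i < key j" if "N i < N j" "i \<in> {1..k-1}" for i j
  proof -
    have "key i < (N i + 1) * k" using that by (auto simp: key_def)
    also have "\<dots> \<le> N j * k" using that by (intro mult_right_mono) auto
    finally show ?thesis by (simp add: key_def)
  qed
  have inj: "inj_on key {1..k-1}"
  proof (rule inj_onI)
    fix i j assume "i \<in> {1..k-1}" "j \<in> {1..k-1}" "key i = key j"
    moreover from this key_less have "N i = N j" by (metis less_irrefl linorder_neqE_nat)
    ultimately show "i = j" by (simp add: key_def)
  qed
  have \<rho>: "\<rho> permutes {1..k-1}" unfolding \<rho>_def by (rule rank_permutes[OF inj])
  have val: "x i = v i + of_bool (i \<in> S x)" if x: "x \<in> \<sigma>" and i: "i \<in> {1..k-1}" for x i
  proof -
    obtain a b where ab: "x i = of_int a" "v i = of_int b"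
      using W_memD(3)[OF _ i] x \<sigma>W v by (metis Ints_cases subsetD)
    have "v i \<le> x i" "x i \<le> v i + 1" using bet[OF x] i by (auto simp: below_within_one_def)
    then have "b \<le> a" "a \<le> b + 1" unfolding ab by linarith+
    then have "a = b \<or> a = b + 1" by linarith
    then show ?thesis using i ab by (auto simp: S_def)
  qed
  have nested: "S x \<subseteq> S y \<or> S y \<subseteq> S x" if "x \<in> \<sigma>" "y \<in> \<sigma>" for x y
  proof -
    have "S x \<subseteq> S y" if "x \<in> \<sigma>" "y \<in> \<sigma>" "below_within_one k x y" for x y
    proof
      fix i assume i: "i \<in> S x"
      then have I: "i \<in> {1..k-1}" by (auto simp: S_def)
      then have "x i \<le> y i" using that by (auto simp: below_within_one_def)
      then show "i \<in> S y" using val[OF that(1) I] val[OF that(2) I] i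
        by (auto split: if_splits simp: of_bool_def)
    qed
    then show ?thesis using pair that by blast
  qed
  \<comment> \<open>A vertex that raises \<open>j\<close> has an increment set not contained in
    \<open>S x\<close>, so by nestedness it contains \<open>S x\<close> and raises \<open>i\<close>
    too. The vertex \<open>x\<close> raises only \<open>i\<close>, hence
    \<open>N j < N i\<close>.\<close>
  have upper: "key j < key i" if "x \<in> \<sigma>" "i \<in> S x" "j \<in> {1..k-1} - S x" for x i j
  proof (rule key_less)
    show "N j < N i" unfolding N_def
    proof (rule psubset_card_mono)
      have "{y \<in> \<sigma>. j \<in> S y} \<subseteq> {y \<in> \<sigma>. i \<in> S y}" using nested that by blast
      moreover have "x \<in> {y \<in> \<sigma>. i \<in> S y}" "x \<notin> {y \<in> \<sigma>. j \<in> S y}" using that by auto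
      ultimately show "{y \<in> \<sigma>. j \<in> S y} \<subset> {y \<in> \<sigma>. i \<in> S y}" by blast
    qed (use fin in auto)
  qed (use that in auto)
  \<comment> \<open>\<open>\<rho>\<close> sends a letter to its position, while a word sends a
    position to its letter.\<close>
  define \<pi> where "\<pi> = inv \<rho>"
  have \<pi>: "\<pi> permutes {1..k-1}" unfolding \<pi>_def by (rule permutes_inv[OF \<rho>])
  have inv\<pi>: "inv \<pi> = \<rho>" unfolding \<pi>_def by (rule permutes_inv_inv[OF \<rho>])
  have "consistent k \<pi> v" unfolding consistent_def inv\<pi>
  proof (intro allI impI)
    fix i assume i: "1 \<le> i \<and> i + 1 \<le> k - 1 \<and> v i = v (i + 1)"
    \<comment> \<open>Points of \<open>W k q\<close> are monotone, so at a tie of \<open>v\<close>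
      raising \<open>i\<close> forces raising \<open>i + 1\<close>. Thus
      \<open>N i \<le> N (i+1)\<close>, and the index as tie-break puts \<open>i\<close>
      first.\<close>
    have "i + 1 \<in> S x" if x: "x \<in> \<sigma>" and ix: "i \<in> S x" for x
    proof -
      have "x i \<le> x (i+1)" using W_memD(4)[of x k q i "i+1"] x \<sigma>W i by auto
      then show ?thesis using val[OF x, of i] val[OF x, of "i+1"] i ix
        by (auto split: if_splits simp: of_bool_def)
    qed
    then have "N i \<le> N (i+1)" unfolding N_def using fin by (intro card_mono) auto
    then have "N i * k \<le> N (i+1) * k" by (rule mult_right_mono) simp
    then have "key i < key (i+1)" unfolding key_def by linarith
    then have "{j \<in> {1..k-1}. key j \<le> key i} \<subset> {j \<in> {1..k-1}. key j \<le> key (i+1)}"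
      using i by force
    then show "\<rho> i < \<rho> (i+1)" using i by (auto simp: \<rho>_def intro!: psubset_card_mono)
  qed
  moreover have "\<sigma> \<subseteq> simplex_F k v \<pi>"
  proof
    fix x assume x: "x \<in> \<sigma>"
    \<comment> \<open>\<open>S x\<close> turns out to be the set of the last \<open>m\<close>
      letters of the word, so \<open>x\<close> is reached after \<open>m\<close> increments.\<close>
    define m where "m = card (S x)"
    have SI: "S x \<subseteq> {1..k-1}" by (auto simp: S_def)
    have m: "m \<le> k-1" using card_mono[OF _ SI] by (simp add: m_def)
    have comp: "card ({1..k-1} - S x) = k - 1 - m"
      using SI by (simp add: card_Diff_subset finite_subset m_def)
    have mem: "i \<in> S x \<longleftrightarrow> \<rho> i \<in> {k-m..k-1}" if i: "i \<in> {1..k-1}" for i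
    proof
      assume ix: "i \<in> S x"
      then have "insert i ({1..k-1} - S x) \<subseteq> {j \<in> {1..k-1}. key j \<le> key i}"
        using upper[OF x ix] i by (auto simp: less_imp_le)
      then have "card (insert i ({1..k-1} - S x)) \<le> \<rho> i"
        using i by (auto simp: \<rho>_def intro!: card_mono)
      then have "k - m \<le> \<rho> i" using ix comp m i by auto
      moreover have "\<rho> i \<in> {1..k-1}" using permutes_in_image[OF \<rho>] i by simp
      ultimately show "\<rho> i \<in> {k-m..k-1}" by auto
    next
      assume r: "\<rho> i \<in> {k-m..k-1}"
      show "i \<in> S x"
      proof (rule ccontr)
        assume ix: "i \<notin> S x"
        then have "{j \<in> {1..k-1}. key j \<le> key i} \<subseteq> {1..k-1} - S x"
          using upper[OF x] i by fastforce
        then have "\<rho> i \<le> k - 1 - m"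
          using i comp card_mono[of "{1..k-1} - S x"] by (auto simp: \<rho>_def)
        then show False using r m i by auto
      qed
    qed
    have "x = simplex_vertex k v \<pi> m"
    proof
      fix i
      have img: "i \<in> \<pi> ` {k-m..k-1} \<longleftrightarrow> \<rho> i \<in> {k-m..k-1}"
        using permutes_mem_image_iff[OF \<pi>] unfolding inv\<pi> .
      show "x i = simplex_vertex k v \<pi> m i"
      proof (cases "i \<in> {1..k-1}")
        case True
        then show ?thesis using val[OF x True] mem[OF True] img
          by (simp add: simplex_vertex_eq[OF k \<pi> m])
      next
        case False
        then have "\<rho> i \<notin> {1..k-1}" using permutes_in_image[OF \<rho>] by simp
        then have "i \<notin> \<pi> ` {k-m..k-1}" unfolding img using m k by auto
        moreover have "x i = v i" using False W_memD(5) x \<sigma>W v by (metis extensional_arb subsetD)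
        ultimately show ?thesis by (simp add: simplex_vertex_eq[OF k \<pi> m])
      qed
    qed
    then show "x \<in> simplex_F k v \<pi>" using m by (auto simp: simplex_F_def)
  qed
  ultimately show ?thesis using \<pi> that by blast
qed

text \<open>At a tie of \<open>v\<close>, consistency places \<open>i + 1\<close> later in the word
  than \<open>i\<close>, so \<open>i + 1\<close> is raised first. A strict increase between integers
  is at least 1 and absorbs one increment. Either way a vertex stays monotone.\<close>

lemma simplex_F_subset_W:
  assumes k: "k \<ge> 1" and v: "v \<in> W k q" "\<And>i. i \<in> {1..k-1} \<Longrightarrow> v i + 1 \<le> real q"
    and \<pi>: "\<pi> permutes {1..k-1}" "consistent k \<pi> v"
  shows "simplex_F k v \<pi> \<subseteq> W k q"
proof
  fix x assume "x \<in> simplex_F k v \<pi>"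
  then obtain m where m: "m \<le> k-1" "x = simplex_vertex k v \<pi> m" by (auto simp: simplex_F_def)
  have img: "i \<in> \<pi> ` {k-m..k-1} \<longleftrightarrow> inv \<pi> i \<in> {k-m..k-1}" for i
    by (rule permutes_mem_image_iff[OF \<pi>(1)])
  have x: "x i = v i + of_bool (inv \<pi> i \<in> {k-m..k-1})" for i
    by (simp only: m(2) simplex_vertex_eq[OF k \<pi>(1) m(1)] img)
  have range: "inv \<pi> i \<in> {1..k-1} \<longleftrightarrow> i \<in> {1..k-1}" for i
    using permutes_in_image[OF permutes_inv[OF \<pi>(1)]] .
  show "x \<in> W k q"
  proof (rule W_memI)
    show "x \<in> extensional {1..k-1}"
      unfolding extensional_def
    proof (intro CollectI allI impI)
      fix i assume i: "i \<notin> {1..k-1}"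
      then have "inv \<pi> i \<notin> {k-m..k-1}" using range[of i] m(1) k by auto
      then show "x i = undefined" using x[of i] extensional_arb[OF W_memD(5)[OF v(1)] i] by simp
    qed
  next
    fix i assume i: "i \<in> {1..k-1}"
    then show "0 \<le> x i \<and> x i \<le> real q \<and> x i \<in> \<int>"
      using W_memD(1,2,3)[OF v(1) i] v(2)[OF i] by (auto simp: x of_bool_def)
  next
    have x_step: "x i \<le> x (Suc i)" if "1 \<le> i" "Suc i \<le> k-1" for i
    proof (cases "v i = v (Suc i)")
      case True
      then have "inv \<pi> i < inv \<pi> (Suc i)" using \<pi>(2) that by (auto simp: consistent_def)
      moreover have "inv \<pi> (Suc i) \<in> {1..k-1}" using range that by auto
      ultimately show ?thesis using True by (auto simp: x of_bool_def)
    next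
      case False
      have "v i \<in> \<int>" "v (Suc i) \<in> \<int>" using that by (auto intro!: W_memD(3)[OF v(1)])
      then obtain a b where ab: "v i = of_int a" "v (Suc i) = of_int b" by (auto elim!: Ints_cases)
      have "v i < v (Suc i)" using W_memD(4)[OF v(1), of i "Suc i"] that False by simp
      then have "a < b" unfolding ab by simp
      then have "v i + 1 \<le> v (Suc i)" unfolding ab by linarith
      then show ?thesis by (auto simp: x of_bool_def)
    qed
    fix i j assume ij: "1 \<le> i" "i \<le> j" "j \<le> k-1"
    from ij(2,3) show "x i \<le> x j"
    proof (induction j rule: dec_induct)
      case (step n)
      then have "x n \<le> x (Suc n)" using x_step ij(1) by simp
      then show ?case using step by simp
    qed simp
  qed
qed

text \<open>\<open>between_imp_subset_facet\<close> asks only for a base point of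
  \<open>W k q\<close> that is within one below all of \<sigma>. The work is to find a base point
  whose facet does not leave \<open>W k q\<close>.\<close>

lemma mem_T_iff:
  assumes k: "k \<ge> 1" and q: "q \<ge> 1" and ne: "\<sigma> \<noteq> {}"
  shows "\<sigma> \<in> T k q \<longleftrightarrow> \<sigma> \<subseteq> W k q \<and>
    (\<forall>x\<in>\<sigma>. \<forall>y\<in>\<sigma>. below_within_one k x y \<or> below_within_one k y x)"
    (is "_ \<longleftrightarrow> ?R")
proof
  assume "\<sigma> \<in> T k q"
  then obtain v \<pi> where "\<sigma> \<subseteq> simplex_F k v \<pi>" "simplex_F k v \<pi> \<subseteq> W k q" "\<pi> permutes {1..k-1}"
    by (auto simp: T_def T_facets_def)
  then show ?R using facet_pairwise[OF k] by (meson subset_iff)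
next
  assume ?R
  then have \<sigma>W: "\<sigma> \<subseteq> W k q"
    and pair: "\<And>x y. \<lbrakk>x \<in> \<sigma>; y \<in> \<sigma>\<rbrakk> \<Longrightarrow> below_within_one k x y \<or> below_within_one k y x" by auto
  have fin: "finite \<sigma>" using \<sigma>W finite_W by (rule finite_subset)
  define M where "M i = Max ((\<lambda>x. x i) ` \<sigma>)" for i
  \<comment> \<open>The least member of \<sigma> may have a coordinate equal to \<open>q\<close>,
    and no facet based there stays in \<open>W k q\<close>. One below the coordinatewise maximum,
    cut off at 0, is a base point with all coordinates at most q - 1, by
    \<open>q \<ge> 1\<close>.\<close>
  define v where "v = restrict (\<lambda>i. max (M i - 1) 0) {1..k-1}"
  have le_M: "x i \<le> M i" if "x \<in> \<sigma>" for x i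
    using that fin by (auto simp: M_def)
  have M_in: "\<exists>x\<in>\<sigma>. M i = x i" for i
  proof -
    have "M i \<in> (\<lambda>x. x i) ` \<sigma>" unfolding M_def by (rule Max_in) (use fin ne in auto)
    then show ?thesis by auto
  qed
  have vW: "v \<in> W k q"
  proof (rule W_memI)
    fix i assume i: "i \<in> {1..k-1}"
    obtain x where x: "x \<in> \<sigma>" "M i = x i" using M_in by blast
    then have "x i \<le> q" "x i \<in> \<int>" using W_memD(2,3)[OF _ i] \<sigma>W by auto
    then show "0 \<le> v i \<and> v i \<le> real q \<and> v i \<in> \<int>" using i x by (auto simp: v_def max_def)
  next
    fix i j assume ij: "1 \<le> i" "i \<le> j" "j \<le> k-1"
    obtain x where x: "x \<in> \<sigma>" "M i = x i" using M_in by blast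
    then have "x i \<le> x j" using W_memD(4) ij \<sigma>W by blast
    then have "M i \<le> M j" using x le_M[OF x(1), of j] by simp
    then show "v i \<le> v j" using ij by (auto simp: v_def)
  qed (simp add: v_def)
  have v1: "v i + 1 \<le> real q" if i: "i \<in> {1..k-1}" for i
  proof -
    obtain x where x: "x \<in> \<sigma>" "M i = x i" using M_in by blast
    then have "x i \<le> q" using W_memD(2)[OF _ i] \<sigma>W by auto
    then show ?thesis using x q i by (auto simp: v_def)
  qed
  have bet: "below_within_one k v x" if x: "x \<in> \<sigma>" for x
    unfolding below_within_one_def
  proof
    fix i assume i: "i \<in> {1..k-1}"
    obtain y where y: "y \<in> \<sigma>" "M i = y i" using M_in by blast
    have "y i \<le> x i + 1" using pair[OF x y(1)] i by (force simp: below_within_one_def)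
    moreover have "0 \<le> x i" using W_memD(1)[OF _ i] x \<sigma>W by auto
    ultimately show "v i \<le> x i \<and> x i \<le> v i + 1" using le_M[OF x, of i] y i by (auto simp: v_def)
  qed
  obtain \<pi> where \<pi>: "\<pi> permutes {1..k-1}" "consistent k \<pi> v" "\<sigma> \<subseteq> simplex_F k v \<pi>"
    by (rule between_imp_subset_facet[OF k vW fin \<sigma>W bet pair])
  then show "\<sigma> \<in> T k q"
    using simplex_F_subset_W[OF k vW v1 \<pi>(1,2)] vW by (auto simp: T_def T_facets_def)
qed

section \<open>Conjugate staircases\<close>

definition staircases :: "nat \<Rightarrow> nat \<Rightarrow> (int \<Rightarrow> int) set" where
  "staircases k q = {g. mono g \<and> (\<forall>c. g (c + int q) = g c + int k)}"

definition shift :: "(int \<Rightarrow> int) \<Rightarrow> int \<Rightarrow> int" where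
  "shift g = (\<lambda>c. g (c + 1))"

text \<open>For \<open>w\<close> in \<open>W k q\<close> this is the largest index i with x_i \<le>
  c, where x_0 = 0, x_i = \<open>w i\<close> for 0 < i < k, and x_(i+k) = x_i + q. The extra entry
  x_0 in each period explains \<open>k\<close> in place of \<open>k - 1\<close>; a coordinate equal
  to \<open>q\<close> is counted together with x_k = q, in the next period.\<close>

definition counting :: "nat \<Rightarrow> nat \<Rightarrow> (nat \<Rightarrow> real) \<Rightarrow> int \<Rightarrow> int" where
  "counting k q w = (\<lambda>c. int (card {i \<in> {1..k-1}. w i \<le> of_int (c mod int q)}) + int k * (c div int q))"

lemma mono_int_iff_step: "mono (g :: int \<Rightarrow> int) \<longleftrightarrow> (\<forall>c. g c \<le> g (c + 1))"
proof
  assume *: "\<forall>c. g c \<le> g (c + 1)"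
  show "mono g"
  proof
    fix x y :: int assume "x \<le> y"
    then show "g x \<le> g y"
      by (induction y rule: int_ge_induct) (use * order_trans in blast)+
  qed
qed (auto simp: mono_def)

lemma staircase_add_mult:
  assumes "g \<in> staircases k q"
  shows "g (c + int q * m) = g c + int k * m"
proof -
  have step: "g (c + int q) = g c + int k" for c using assms by (simp add: staircases_def)
  show ?thesis
  proof (induction m rule: int_induct[where k=0])
    case (step1 i)
    then show ?case using step[of "c + int q * i"] by (simp add: algebra_simps)
  next
    case (step2 i)
    then show ?case using step[of "c + int q * (i - 1)"] by (simp add: algebra_simps)
  qed simp
qed

lemma staircase_eq_mod:
  assumes "g \<in> staircases k q"
  shows "g c = g (c mod int q) + int k * (c div int q)"
  using staircase_add_mult[OF assms, of "c mod int q" "c div int q"] by simp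

lemma staircases_le_iff:
  assumes "q \<ge> 1" "g \<in> staircases k q" "h \<in> staircases k q"
  shows "g \<le> h \<longleftrightarrow> (\<forall>c\<in>{0..<int q}. g c \<le> h c)"
proof
  assume *: "\<forall>c\<in>{0..<int q}. g c \<le> h c"
  show "g \<le> h"
  proof (rule le_funI)
    fix c
    have "g (c mod int q) \<le> h (c mod int q)" using * assms(1) by auto
    then show "g c \<le> h c" using staircase_eq_mod[OF assms(2), of c] staircase_eq_mod[OF assms(3), of c]
      by simp
  qed
qed (simp add: le_fun_def)

lemma shift_le_shift_iff [simp]: "shift g \<le> shift h \<longleftrightarrow> g \<le> h"
  unfolding le_fun_def shift_def by (metis diff_add_cancel)

lemma shift_eq_shift_iff [simp]: "shift g = shift h \<longleftrightarrow> g = h"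
  by (simp add: order_eq_iff)

lemma shift_in_staircases: "g \<in> staircases k q \<Longrightarrow> shift g \<in> staircases k q"
  unfolding staircases_def shift_def mono_def by (auto simp: add.assoc add.commute[of _ 1]) (simp flip: add.assoc)

lemma le_shift: "g \<in> staircases k q \<Longrightarrow> g \<le> shift g"
  by (auto simp: staircases_def shift_def mono_def le_fun_def)

lemma counting_in_staircases:
  assumes "k \<ge> 1" "q \<ge> 1"
  shows "counting k q w \<in> staircases k q"
proof -
  have "counting k q w c \<le> counting k q w (c + 1)" for c
  proof -
    have eq: "c = int q * (c div int q) + c mod int q" by simp
    show ?thesis
    proof (cases "c mod int q + 1 = int q")
      \<comment> \<open>At the end of a period the count falls from at most k - 1 back to the count
        at 0, and the added k outweighs the fall.\<close>
      case True
      have "(c + 1) mod int q = 0" "(c + 1) div int q = c div int q + 1"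
        using int_mod_pos_eq[of "c + 1" "int q" "c div int q + 1" 0]
          int_div_pos_eq[of "c + 1" "int q" "c div int q + 1" 0] True assms(2) eq
        by (simp_all add: algebra_simps)
      moreover have "card {i \<in> {1..k-1}. w i \<le> of_int (c mod int q)} \<le> card {1..k-1}"
        by (rule card_mono) auto
      ultimately show ?thesis using assms(1) by (simp add: counting_def algebra_simps)
    next
      case False
      moreover have "c mod int q < int q" using assms(2) by simp
      ultimately have lt: "c mod int q + 1 < int q" by linarith
      have "(c + 1) mod int q = c mod int q + 1" "(c + 1) div int q = c div int q"
        using int_mod_pos_eq[of "c + 1" "int q" "c div int q" "c mod int q + 1"]
          int_div_pos_eq[of "c + 1" "int q" "c div int q" "c mod int q + 1"] lt eq assms(2)
        by simp_all
      then show ?thesis by (auto simp: counting_def intro!: card_mono)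
    qed
  qed
  then show ?thesis using assms(2)
    by (auto simp: staircases_def mono_int_iff_step) (simp add: counting_def algebra_simps)
qed

text \<open>The coordinates increase, so those that are at most \<open>c\<close> carry the indices
  from 1 up to their number.\<close>

lemma le_counting_iff:
  assumes "w \<in> W k q" "i \<in> {1..k-1}" "0 \<le> c" "c < int q"
  shows "int i \<le> counting k q w c \<longleftrightarrow> w i \<le> of_int c"
proof -
  define S where "S = {j \<in> {1..k-1}. w j \<le> of_int c}"
  have val: "counting k q w c = int (card S)" using assms by (simp add: counting_def S_def)
  have down: "j \<in> S" if "l \<in> S" "1 \<le> j" "j \<le> l" for j l
    using that W_memD(4)[OF assms(1), of j l] by (auto simp: S_def)
  show ?thesis
  proof
    assume "w i \<le> of_int c"
    then have "i \<in> S" using assms by (simp add: S_def)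
    then have "{1..i} \<subseteq> S" using down by auto
    then have "card {1..i} \<le> card S" by (intro card_mono) (auto simp: S_def)
    then show "int i \<le> counting k q w c" by (simp add: val)
  next
    assume i: "int i \<le> counting k q w c"
    show "w i \<le> of_int c"
    proof (rule ccontr)
      assume "\<not> w i \<le> of_int c"
      then have "i \<notin> S" by (simp add: S_def)
      have "j \<in> {1..i-1}" if "j \<in> S" for j
      proof -
        have "\<not> i \<le> j" using down[OF that, of i] \<open>i \<notin> S\<close> assms(2) by auto
        then show ?thesis using that by (auto simp: S_def)
      qed
      then have "S \<subseteq> {1..i-1}" by blast
      then have "card S \<le> i - 1" using card_mono[of "{1..i-1}" S] by simp
      then show False using i val assms(2) by auto
    qed
  qed
qed

lemma counting_bounds:
  assumes "k \<ge> 1" "0 \<le> c" "c < int q"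
  shows "0 \<le> counting k q w c" "counting k q w c < int k"
proof -
  have "card {i \<in> {1..k-1}. w i \<le> of_int c} \<le> card {1..k-1}" by (rule card_mono) auto
  then show "0 \<le> counting k q w c" "counting k q w c < int k" using assms by (auto simp: counting_def)
qed

text \<open>This normalization picks one function from each orbit under \<open>shift\<close>; the
  values at -1 then tell a conjugate from a shifted conjugate.\<close>

lemma counting_normalized:
  assumes "k \<ge> 1" "q \<ge> 1"
  shows "counting k q w (-1) < 0" "0 \<le> counting k q w 0"
  using counting_bounds[OF assms(1), of "int q - 1" q w] counting_bounds[OF assms(1), of 0 q w] assms
    staircase_add_mult[OF counting_in_staircases[OF assms, of w], of "-1" 1] by auto

text \<open>Made for conjugates on one period: their values lie in 0, ..., k - 1, and only
  thresholds in {1..k-1} name a coordinate.\<close>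

lemma le_if_thresholds:
  fixes x y :: int
  assumes "x < int k" "0 \<le> y" "\<And>i. \<lbrakk>i \<in> {1..k-1}; int i \<le> x\<rbrakk> \<Longrightarrow> int i \<le> y"
  shows "x \<le> y"
proof (cases "0 < x")
  case True
  then have "nat x \<in> {1..k-1}" using assms(1) by auto
  then show ?thesis using assms(3)[of "nat x"] True by simp
qed (use assms(2) in simp)

text \<open>A larger point has fewer coordinates below each threshold. The thresholds 0, ..., q - 1
  are enough for the converse, because a coordinate of \<open>y\<close> above all of them is
  \<open>q\<close>, which bounds \<open>x\<close> anyway.\<close>

lemma counting_le_iff:
  assumes "x \<in> W k q" "y \<in> W k q" "k \<ge> 1" "q \<ge> 1"
  shows "counting k q y \<le> counting k q x \<longleftrightarrow> (\<forall>i\<in>{1..k-1}. x i \<le> y i)"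
proof -
  have st: "counting k q x \<in> staircases k q" "counting k q y \<in> staircases k q"
    using counting_in_staircases assms by auto
  have "counting k q y \<le> counting k q x \<longleftrightarrow> (\<forall>c\<in>{0..<int q}. counting k q y c \<le> counting k q x c)"
    by (rule staircases_le_iff[OF assms(4) st(2,1)])
  also have "\<dots> \<longleftrightarrow> (\<forall>c\<in>{0..<int q}. \<forall>i\<in>{1..k-1}. y i \<le> of_int c \<longrightarrow> x i \<le> of_int c)"
  proof (rule ball_cong[OF refl])
    fix c assume c: "c \<in> {0..<int q}"
    have b: "0 \<le> counting k q y c" "counting k q y c < int k"
      using counting_bounds[OF assms(3), of c q y] c by auto
    show "counting k q y c \<le> counting k q x c \<longleftrightarrow> (\<forall>i\<in>{1..k-1}. y i \<le> of_int c \<longrightarrow> x i \<le> of_int c)"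
    proof
      assume "counting k q y c \<le> counting k q x c"
      then show "\<forall>i\<in>{1..k-1}. y i \<le> of_int c \<longrightarrow> x i \<le> of_int c"
        using le_counting_iff[OF assms(1)] le_counting_iff[OF assms(2)] c
        by (metis atLeastLessThan_iff order_trans)
    next
      assume *: "\<forall>i\<in>{1..k-1}. y i \<le> of_int c \<longrightarrow> x i \<le> of_int c"
      show "counting k q y c \<le> counting k q x c"
        by (rule le_if_thresholds[OF b(2) counting_bounds(1)[OF assms(3)]])
          (use c * le_counting_iff[OF assms(1)] le_counting_iff[OF assms(2)] in auto)
    qed
  qed
  also have "\<dots> \<longleftrightarrow> (\<forall>i\<in>{1..k-1}. x i \<le> y i)"
  proof
    assume *: "\<forall>c\<in>{0..<int q}. \<forall>i\<in>{1..k-1}. y i \<le> of_int c \<longrightarrow> x i \<le> of_int c"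
    show "\<forall>i\<in>{1..k-1}. x i \<le> y i"
    proof
      fix i assume i: "i \<in> {1..k-1}"
      obtain b where b: "y i = of_int b" using W_memD(3)[OF assms(2) i] by (auto elim: Ints_cases)
      show "x i \<le> y i"
      proof (cases "b < int q")
        case True
        moreover have "0 \<le> b" using W_memD(1)[OF assms(2) i] b by simp
        ultimately show ?thesis using * i b by auto
      next
        case False
        then show ?thesis using W_memD(2)[OF assms(1) i] b by linarith
      qed
    qed
  qed force
  finally show ?thesis .
qed

lemma counting_le_shift_iff:
  assumes "x \<in> W k q" "y \<in> W k q" "k \<ge> 1" "q \<ge> 1"
  shows "counting k q x \<le> shift (counting k q y) \<longleftrightarrow> (\<forall>i\<in>{1..k-1}. y i \<le> x i + 1)"
proof
  assume le: "counting k q x \<le> shift (counting k q y)"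
  show "\<forall>i\<in>{1..k-1}. y i \<le> x i + 1"
  proof
    fix i assume i: "i \<in> {1..k-1}"
    obtain a where a: "x i = of_int a" using W_memD(3)[OF assms(1) i] by (auto elim: Ints_cases)
    have a0: "0 \<le> a" using W_memD(1)[OF assms(1) i] a by simp
    show "y i \<le> x i + 1"
    proof (cases "a + 1 < int q")
      case True
      then have "int i \<le> counting k q x a" using le_counting_iff[OF assms(1) i, of a] a0 a by simp
      also have "\<dots> \<le> counting k q y (a + 1)" using le by (simp add: le_fun_def shift_def)
      finally show ?thesis using le_counting_iff[OF assms(2) i, of "a + 1"] True a0 a by simp
    next
      case False
      then show ?thesis using W_memD(2)[OF assms(2) i] a by linarith
    qed
  qed
next
  assume *: "\<forall>i\<in>{1..k-1}. y i \<le> x i + 1"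
  have st: "counting k q x \<in> staircases k q" "counting k q y \<in> staircases k q"
    using counting_in_staircases assms by auto
  have "counting k q x c \<le> counting k q y (c + 1)" if c: "c \<in> {0..<int q}" for c
  proof -
    have b: "0 \<le> counting k q x c" "counting k q x c < int k"
      using counting_bounds[OF assms(3), of c q x] c by auto
    \<comment> \<open>\<open>le_counting_iff\<close> needs a threshold below \<open>q\<close> and an
      index in {1..k-1}. It misses the wrap into the next period, where \<open>k\<close> is added,
      and a count of 0.\<close>
    consider "c + 1 = int q" | "counting k q x c = 0" "c + 1 < int q" | "counting k q x c > 0" "c + 1 < int q"
      using c b by force
    then show ?thesis
    proof cases
      case 1
      then have "counting k q y (c + 1) = counting k q y 0 + int k"
        using staircase_add_mult[OF st(2), of 0 1] by simp
      then show ?thesis using b counting_normalized(2)[OF assms(3,4), of y] by simp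
    next
      case 2
      then show ?thesis using counting_bounds(1)[OF assms(3), of "c + 1" q y] c by auto
    next
      case 3
      have i: "nat (counting k q x c) \<in> {1..k-1}" using b 3 by auto
      have "x (nat (counting k q x c)) \<le> of_int c"
        using le_counting_iff[OF assms(1) i, of c] c b by auto
      then have "y (nat (counting k q x c)) \<le> of_int (c + 1)" using * i by force
      then show ?thesis using le_counting_iff[OF assms(2) i, of "c + 1"] c 3 by auto
    qed
  qed
  then show "counting k q x \<le> shift (counting k q y)"
    using staircases_le_iff[OF assms(4) st(1) shift_in_staircases[OF st(2)]] by (simp add: shift_def)
qed

lemma below_within_one_iff_counting:
  assumes "x \<in> W k q" "y \<in> W k q" "k \<ge> 1" "q \<ge> 1"
  shows "below_within_one k x y \<longleftrightarrow>
    counting k q y \<le> counting k q x \<and> counting k q x \<le> shift (counting k q y)"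
  using counting_le_iff[OF assms] counting_le_shift_iff[OF assms] by (auto simp: below_within_one_def)

lemma counting_inj:
  assumes "x \<in> W k q" "y \<in> W k q" "k \<ge> 1" "q \<ge> 1" "counting k q x = counting k q y"
  shows "x = y"
proof (rule W_eqI[OF assms(1,2)])
  fix i assume "i \<in> {1..k-1}"
  then show "x i = y i"
    using counting_le_iff[OF assms(1,2,3,4)] counting_le_iff[OF assms(2,1,3,4)] assms(5)
    by (intro order_antisym) simp_all
qed

text \<open>Conjugating back: the coordinate \<open>w i\<close> is the number of c in one period
  with g c < i. By monotonicity this is the least such c with i \<le> g c, or \<open>q\<close> if
  there is none.\<close>

lemma counting_surj:
  assumes g: "g \<in> staircases k q" "g (-1) < 0" "0 \<le> g 0" and kq: "k \<ge> 1" "q \<ge> 1"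
  obtains w where "w \<in> W k q" "counting k q w = g"
proof -
  define C where "C i = {c \<in> {0..<int q}. g c < int i}" for i :: nat
  define w where "w = restrict (\<lambda>i. real (card (C i))) {1..k-1}"
  have finC: "finite (C i)" for i
    by (rule finite_subset[of _ "{0..<int q}"]) (auto simp: C_def)
  have mono: "g a \<le> g b" if "a \<le> b" for a b
    using g(1) that by (auto simp: staircases_def mono_def)
  have Ciff: "card (C i) \<le> nat c \<longleftrightarrow> int i \<le> g c" if c: "0 \<le> c" "c < int q" for i c
  proof
    assume *: "card (C i) \<le> nat c"
    show "int i \<le> g c"
    proof (rule ccontr)
      assume "\<not> int i \<le> g c"
      then have "{0..c} \<subseteq> C i" using c mono by (force simp: C_def)
      then have "card {0..c} \<le> card (C i)" by (intro card_mono finC)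
      then show False using * c by simp
    qed
  next
    assume i: "int i \<le> g c"
    have "C i \<subseteq> {0..<c}"
    proof
      fix d assume d: "d \<in> C i"
      then have "\<not> c \<le> d" using mono[of c d] i by (auto simp: C_def)
      then show "d \<in> {0..<c}" using d by (auto simp: C_def)
    qed
    then have "card (C i) \<le> card {0..<c}" by (intro card_mono) auto
    then show "card (C i) \<le> nat c" by simp
  qed
  have wW: "w \<in> W k q"
  proof (rule W_memI)
    fix i assume i: "i \<in> {1..k-1}"
    have "card (C i) \<le> card {0..<int q}" by (rule card_mono) (auto simp: C_def)
    then show "0 \<le> w i \<and> w i \<le> real q \<and> w i \<in> \<int>" using i by (simp add: w_def)
  next
    fix i j assume ij: "1 \<le> i" "i \<le> j" "j \<le> k-1"
    have "C i \<subseteq> C j" using ij by (auto simp: C_def)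
    then have "card (C i) \<le> card (C j)" by (intro card_mono finC)
    then show "w i \<le> w j" using ij by (simp add: w_def)
  qed (simp add: w_def)
  have st: "counting k q w \<in> staircases k q" using counting_in_staircases kq by auto
  have "counting k q w c = g c" if c: "0 \<le> c" "c < int q" for c
  proof -
    have "0 \<le> g c" using g(3) mono[of 0 c] c by simp
    \<comment> \<open>Periodicity carries the normalization at -1 to q - 1, where it becomes the
      upper bound \<open>g c < int k\<close>.\<close>
    moreover have "g c \<le> g (-1 + int q)" using mono c by simp
    then have "g c < int k" using g(2) staircase_add_mult[OF g(1), of "-1" 1] by simp
    moreover have "int i \<le> counting k q w c \<longleftrightarrow> int i \<le> g c" if "i \<in> {1..k-1}" for i
    proof -
      have "w i \<le> of_int c \<longleftrightarrow> card (C i) \<le> nat c" using that c by (simp add: w_def) linarith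
      then show ?thesis using le_counting_iff[OF wW that c] Ciff[OF c] by simp
    qed
    ultimately show ?thesis
      using le_if_thresholds[of "g c" k "counting k q w c"] le_if_thresholds[of "counting k q w c" k "g c"]
        counting_bounds[OF kq(1) c, of w] by (intro order_antisym) auto
  qed
  then have "counting k q w = g"
    using staircases_le_iff[OF kq(2) st g(1)] staircases_le_iff[OF kq(2) g(1) st]
    by (auto intro: order_antisym)
  with wW that show ?thesis by blast
qed

section \<open>Flag complexes and products of chains\<close>

text \<open>The pairs include x = y, so reflexivity of \<open>r\<close> on \<open>V\<close> is what
  makes every element of \<open>V\<close> a vertex.\<close>

definition flag_complex :: "'a set \<Rightarrow> ('a \<Rightarrow> 'a \<Rightarrow> bool) \<Rightarrow> 'a set set" where
  "flag_complex V r = {\<sigma>. finite \<sigma> \<and> \<sigma> \<subseteq> V \<and> (\<forall>x\<in>\<sigma>. \<forall>y\<in>\<sigma>. r x y)}"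

lemma Union_flag_complex: "(\<And>x. x \<in> V \<Longrightarrow> r x x) \<Longrightarrow> \<Union>(flag_complex V r) = V"
proof
  assume "\<And>x. x \<in> V \<Longrightarrow> r x x"
  then have "{x} \<in> flag_complex V r" if "x \<in> V" for x using that by (simp add: flag_complex_def)
  then show "V \<subseteq> \<Union>(flag_complex V r)" by blast
qed (auto simp: flag_complex_def)

lemma flag_complex_iso:
  assumes bij: "bij_betw f V V'" and iff: "\<And>x y. \<lbrakk>x \<in> V; y \<in> V\<rbrakk> \<Longrightarrow> r x y \<longleftrightarrow> r' (f x) (f y)"
    and refl: "\<And>x. x \<in> V \<Longrightarrow> r x x"
  shows "flag_complex V r \<cong>\<^sub>c flag_complex V' r'"
  unfolding complex_iso_def
proof (intro exI conjI)
  have img: "f ` V = V'" using bij by (rule bij_betw_imp_surj_on)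
  have refl': "r' y y" if "y \<in> V'" for y using that img iff refl by auto
  show "bij_betw f (\<Union>(flag_complex V r)) (\<Union>(flag_complex V' r'))"
    using bij Union_flag_complex[of V r, OF refl] Union_flag_complex[of V' r', OF refl'] by simp
  show "(`) f ` flag_complex V r = flag_complex V' r'"
  proof (intro equalityI subsetI)
    fix \<tau> assume "\<tau> \<in> (`) f ` flag_complex V r"
    then obtain \<sigma> where \<sigma>: "finite \<sigma>" "\<sigma> \<subseteq> V" "\<forall>x\<in>\<sigma>. \<forall>y\<in>\<sigma>. r x y" "\<tau> = f ` \<sigma>"
      by (auto simp: flag_complex_def)
    have "r' (f x) (f y)" if "x \<in> \<sigma>" "y \<in> \<sigma>" for x y using \<sigma> that iff by blast
    then show "\<tau> \<in> flag_complex V' r'" using \<sigma> img by (auto simp: flag_complex_def)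
  next
    fix \<tau> assume "\<tau> \<in> flag_complex V' r'"
    then have \<tau>: "finite \<tau>" "\<tau> \<subseteq> f ` V" "\<forall>x\<in>\<tau>. \<forall>y\<in>\<tau>. r' x y"
      by (auto simp: flag_complex_def img)
    obtain \<sigma> where \<sigma>: "\<sigma> \<subseteq> V" "finite \<sigma>" "\<tau> = f ` \<sigma>"
      using finite_subset_image[OF \<tau>(1,2)] by blast
    have "r x y" if "x \<in> \<sigma>" "y \<in> \<sigma>" for x y using \<sigma> \<tau>(3) that iff by blast
    then have "\<sigma> \<in> flag_complex V r" using \<sigma> by (auto simp: flag_complex_def)
    then show "\<tau> \<in> (`) f ` flag_complex V r" using \<sigma> by blast
  qed
qed

lemma order_complex_eq_flag:
  "order_complex r = flag_complex (Field r) (\<lambda>x y. (x, y) \<in> r \<or> (y, x) \<in> r)"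
  by (auto simp: order_complex_def flag_complex_def Chains_def Field_def)

text \<open>The tags allow a face of the join to be sliced back into its parts, so only pairs with
  equal tags are constrained.\<close>

lemma complex_join_flag:
  "complex_join (map (\<lambda>i. flag_complex (V i) (r i)) [0..<t]) =
   flag_complex (SIGMA i:{..<t}. V i) (\<lambda>(i, x) (j, y). i = j \<longrightarrow> r i x y)"
proof (intro equalityI subsetI)
  fix \<tau> assume "\<tau> \<in> complex_join (map (\<lambda>i. flag_complex (V i) (r i)) [0..<t])"
  then obtain \<sigma> where \<sigma>: "\<And>i. i < t \<Longrightarrow> \<sigma> i \<in> flag_complex (V i) (r i)" "\<tau> = (\<Union>i<t. Pair i ` \<sigma> i)"
    by (auto simp: complex_join_def)
  have "finite \<tau>" using \<sigma> by (auto simp: flag_complex_def)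
  moreover have "\<tau> \<subseteq> (SIGMA i:{..<t}. V i)" using \<sigma> by (force simp: flag_complex_def)
  moreover have "i = j \<longrightarrow> r i x y" if "(i, x) \<in> \<tau>" "(j, y) \<in> \<tau>" for i x j y
    using \<sigma> that by (force simp: flag_complex_def)
  ultimately show "\<tau> \<in> flag_complex (SIGMA i:{..<t}. V i) (\<lambda>(i, x) (j, y). i = j \<longrightarrow> r i x y)"
    by (auto simp: flag_complex_def)
next
  fix \<tau> assume "\<tau> \<in> flag_complex (SIGMA i:{..<t}. V i) (\<lambda>(i, x) (j, y). i = j \<longrightarrow> r i x y)"
  then have \<tau>: "finite \<tau>" "\<tau> \<subseteq> (SIGMA i:{..<t}. V i)"
    "\<And>i x y. \<lbrakk>(i, x) \<in> \<tau>; (i, y) \<in> \<tau>\<rbrakk> \<Longrightarrow> r i x y" by (auto simp: flag_complex_def)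
  define \<sigma> where "\<sigma> i = {x. (i, x) \<in> \<tau>}" for i
  have "finite (\<sigma> i)" for i
    by (rule finite_subset[of _ "snd ` \<tau>"]) (use \<tau>(1) in \<open>force simp: \<sigma>_def\<close>)+
  then have "\<sigma> i \<in> flag_complex (V i) (r i)" for i
    using \<tau>(2,3) by (auto simp: flag_complex_def \<sigma>_def)
  moreover have "\<tau> = (\<Union>i<t. Pair i ` \<sigma> i)" using \<tau>(2) by (auto simp: \<sigma>_def)
  ultimately show "\<tau> \<in> complex_join (map (\<lambda>i. flag_complex (V i) (r i)) [0..<t])"
    unfolding complex_join_def by (intro CollectI exI[of _ \<sigma>]) simp
qed

lemma mem_prod_of_chains_iff:
  "(xs, ys) \<in> prod_poset (map chain_poset ms) \<longleftrightarrow> length xs = length ms \<and> length ys = length ms \<and>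
    (\<forall>i<length ms. xs ! i \<le> ys ! i \<and> ys ! i \<le> ms ! i)"
  by (auto simp: prod_poset_def chain_poset_def)

lemma Field_prod_of_chains:
  "xs \<in> Field (prod_poset (map chain_poset ms)) \<longleftrightarrow> length xs = length ms \<and> (\<forall>i<length ms. xs ! i \<le> ms ! i)"
  by (auto simp: Field_def Domain_unfold Range.simps mem_prod_of_chains_iff intro: le_trans)

text \<open>The list \<open>ms\<close> is itself the maximum, since the chain at position i ends at
  \<open>ms ! i\<close>; the minimum is the zero list of the same length.\<close>

lemma mem_proper_part_prod_of_chains_iff:
  "(xs, ys) \<in> proper_part (prod_poset (map chain_poset ms)) \<longleftrightarrow>
    (xs, ys) \<in> prod_poset (map chain_poset ms) \<and>
    xs \<noteq> map (\<lambda>_. 0) ms \<and> xs \<noteq> ms \<and> ys \<noteq> map (\<lambda>_. 0) ms \<and> ys \<noteq> ms"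
proof -
  let ?P = "prod_poset (map chain_poset ms)"
  have bot: "(\<forall>y\<in>Field ?P. (x, y) \<in> ?P) \<longleftrightarrow> x = map (\<lambda>_. 0) ms" if "x \<in> Field ?P" for x
  proof
    assume "\<forall>y\<in>Field ?P. (x, y) \<in> ?P"
    moreover have "map (\<lambda>_. 0) ms \<in> Field ?P" by (simp add: Field_prod_of_chains)
    ultimately have "(x, map (\<lambda>_. 0) ms) \<in> ?P" by blast
    then show "x = map (\<lambda>_. 0) ms" by (auto simp: mem_prod_of_chains_iff list_eq_iff_nth_eq)
  qed (auto simp: mem_prod_of_chains_iff Field_prod_of_chains)
  have top: "(\<forall>y\<in>Field ?P. (y, x) \<in> ?P) \<longleftrightarrow> x = ms" if "x \<in> Field ?P" for x
  proof
    assume "\<forall>y\<in>Field ?P. (y, x) \<in> ?P"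
    moreover have "ms \<in> Field ?P" by (simp add: Field_prod_of_chains)
    ultimately have "(ms, x) \<in> ?P" by blast
    then show "x = ms" by (auto simp: mem_prod_of_chains_iff list_eq_iff_nth_eq order_antisym)
  qed (auto simp: mem_prod_of_chains_iff Field_prod_of_chains)
  show ?thesis unfolding proper_part_def using bot top by (auto intro: FieldI1 FieldI2)
qed

lemma Field_proper_part_prod_of_chains:
  "xs \<in> Field (proper_part (prod_poset (map chain_poset ms))) \<longleftrightarrow>
    length xs = length ms \<and> (\<forall>i<length ms. xs ! i \<le> ms ! i) \<and> xs \<noteq> map (\<lambda>_. 0) ms \<and> xs \<noteq> ms"
proof -
  have "xs \<in> Field (proper_part (prod_poset (map chain_poset ms))) \<longleftrightarrow>
      (xs, xs) \<in> proper_part (prod_poset (map chain_poset ms))"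
    by (auto simp: Field_def Domain_unfold Range.simps mem_proper_part_prod_of_chains_iff
        mem_prod_of_chains_iff intro: le_trans)
  then show ?thesis by (auto simp: mem_proper_part_prod_of_chains_iff mem_prod_of_chains_iff)
qed

text \<open>Monotonicity is automatic in the interval, since \<open>b c \<le> a (c + 1)\<close>: the values at the
  \<open>c \<in> {0..<q}\<close> are independent of each other.\<close>

lemma staircase_interval_iso_product:
  assumes q: "q \<ge> 1" and a: "a \<in> staircases k q" and b: "b \<in> staircases k q"
    and ab: "a < b" "b \<le> shift a"
  obtains P \<psi> where "product_of_chains P"
    "bij_betw \<psi> {g \<in> staircases k q. a < g \<and> g < b} (Field (proper_part P))"
    "\<And>g h. \<lbrakk>g \<in> staircases k q; a < g; g < b; h \<in> staircases k q; a < h; h < b\<rbrakk> \<Longrightarrow>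
       (\<psi> g, \<psi> h) \<in> proper_part P \<longleftrightarrow> g \<le> h"
proof -
  \<comment> \<open>Positions with a c = b c would contribute one-point chains, which
    \<open>product_of_chains\<close> excludes by \<open>m \<ge> 1\<close>. Some position remains
    because \<open>a < b\<close>.\<close>
  define cs where "cs = filter (\<lambda>c. a c < b c) [0..int q - 1]"
  define \<psi> where "\<psi> g = map (\<lambda>c. nat (g c - a c)) cs" for g :: "int \<Rightarrow> int"
  define ms where "ms = \<psi> b"
  define P where "P = prod_poset (map chain_poset ms)"
  define I where "I = {g \<in> staircases k q. a \<le> g \<and> g \<le> b}"
  have a_le_b: "a c \<le> b c" for c using ab(1) by (simp add: less_fun_def le_fun_def)
  have in_cs: "c \<in> set cs \<longleftrightarrow> 0 \<le> c \<and> c < int q \<and> a c < b c" for c by (auto simp: cs_def)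
  have aI: "a \<in> I" and bI: "b \<in> I" using a b ab(1) by (auto simp: I_def)
  have I_bounds: "a c \<le> g c \<and> g c \<le> b c" if "g \<in> I" for g c using that by (auto simp: I_def le_fun_def)
  have le_iff: "g \<le> h \<longleftrightarrow> (\<forall>i<length ms. \<psi> g ! i \<le> \<psi> h ! i)" if g: "g \<in> I" and h: "h \<in> I" for g h
  proof -
    have "g \<le> h \<longleftrightarrow> (\<forall>c\<in>{0..<int q}. g c \<le> h c)"
      using g h by (intro staircases_le_iff[OF q]) (auto simp: I_def)
    also have "\<dots> \<longleftrightarrow> (\<forall>c\<in>set cs. g c \<le> h c)"
    proof
      assume *: "\<forall>c\<in>set cs. g c \<le> h c"
      show "\<forall>c\<in>{0..<int q}. g c \<le> h c"
      proof
        fix c assume "c \<in> {0..<int q}"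
        then show "g c \<le> h c" using * I_bounds[OF g, of c] I_bounds[OF h, of c] in_cs[of c]
          by (cases "a c < b c") auto
      qed
    qed (simp add: in_cs)
    also have "\<dots> \<longleftrightarrow> (\<forall>c\<in>set cs. nat (g c - a c) \<le> nat (h c - a c))"
    proof (rule ball_cong[OF refl])
      fix c
      show "g c \<le> h c \<longleftrightarrow> nat (g c - a c) \<le> nat (h c - a c)"
        using I_bounds[OF g, of c] I_bounds[OF h, of c] by auto
    qed
    also have "\<dots> \<longleftrightarrow> (\<forall>i<length ms. \<psi> g ! i \<le> \<psi> h ! i)"
      by (auto simp: \<psi>_def ms_def all_set_conv_all_nth)
    finally show ?thesis .
  qed
  have eq_iff: "\<psi> g = \<psi> h \<longleftrightarrow> g = h" if "g \<in> I" "h \<in> I" for g h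
    using le_iff[OF that] le_iff[OF that(2,1)] order_antisym[of g h] by auto
  have \<psi>a: "\<psi> a = map (\<lambda>_. 0) ms" by (simp add: \<psi>_def ms_def o_def)
  have len: "length (\<psi> g) = length ms" for g by (simp add: \<psi>_def ms_def)
  have \<psi>_le: "\<forall>i<length ms. \<psi> g ! i \<le> ms ! i" if "g \<in> I" for g
    using iffD1[OF le_iff[OF that bI]] that by (simp add: ms_def I_def)
  have "cs \<noteq> []"
  proof
    assume "cs = []"
    then have "ms = []" by (simp add: ms_def \<psi>_def)
    then have "b \<le> a" using le_iff[OF bI aI] by simp
    then show False using ab(1) by simp
  qed
  then have "product_of_chains P"
    unfolding product_of_chains_def P_def
    by (intro exI[of _ ms]) (auto simp: ms_def \<psi>_def in_cs)
  moreover have surj: "xs \<in> \<psi> ` I" if xs: "length xs = length ms" "\<forall>i<length ms. xs ! i \<le> ms ! i" for xs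
  proof -
    \<comment> \<open>The offset of \<open>g\<close> from \<open>a\<close>: read from
      \<open>xs\<close> at the positions in \<open>cs\<close>, and 0 elsewhere. Taken at
      \<open>c mod int q\<close> it is periodic, so \<open>g\<close> advances by \<open>k\<close>
      per period as \<open>a\<close> does.\<close>
    define \<delta> where "\<delta> c = (case map_of (zip cs xs) c of None \<Rightarrow> 0 | Some x \<Rightarrow> int x)" for c
    define g where "g c = a c + \<delta> (c mod int q)" for c
    have dist: "distinct cs" by (simp add: cs_def)
    have lcs: "length xs = length cs" using xs by (simp add: ms_def \<psi>_def)
    have \<delta>_nth: "\<delta> (cs ! i) = int (xs ! i)" if "i < length cs" for i
      using that map_of_zip_nth[OF lcs[symmetric] dist] lcs by (simp add: \<delta>_def)
    have \<delta>_out: "\<delta> c = 0" if "c \<notin> set cs" for c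
      using that lcs by (simp add: \<delta>_def map_of_zip_is_None[THEN iffD2])
    have \<delta>_bounds: "0 \<le> \<delta> c \<and> \<delta> c \<le> b c - a c" for c
    proof (cases "c \<in> set cs")
      case True
      then obtain i where i: "i < length cs" "c = cs ! i" by (auto simp: in_set_conv_nth)
      then have "xs ! i \<le> nat (b c - a c)" using xs by (simp add: ms_def \<psi>_def)
      then show ?thesis using \<delta>_nth[OF i(1)] i(2) a_le_b[of c] by simp
    qed (use \<delta>_out a_le_b in simp)
    have g_bounds: "a c \<le> g c \<and> g c \<le> b c" for c
      using \<delta>_bounds[of "c mod int q"] staircase_eq_mod[OF a, of c] staircase_eq_mod[OF b, of c]
      by (simp add: g_def)
    have "g c \<le> g (c + 1)" for c
    proof -
      have "b c \<le> a (c + 1)" using ab(2) by (simp add: le_fun_def shift_def)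
      then show ?thesis using g_bounds[of c] g_bounds[of "c + 1"] by linarith
    qed
    then have "g \<in> staircases k q"
      using staircase_add_mult[OF a, of _ 1] by (simp add: staircases_def mono_int_iff_step) (simp add: g_def)
    then have "g \<in> I" using g_bounds by (simp add: I_def le_fun_def)
    moreover have "\<psi> g = xs"
    proof (rule nth_equalityI)
      fix i assume "i < length (\<psi> g)"
      then have i: "i < length cs" by (simp add: \<psi>_def)
      have "cs ! i mod int q = cs ! i" using in_cs[of "cs ! i"] i by simp
      then show "\<psi> g ! i = xs ! i" using i \<delta>_nth[OF i] by (simp add: \<psi>_def g_def)
    qed (use lcs in \<open>simp add: \<psi>_def\<close>)
    ultimately show ?thesis by blast
  qed
  have open_eq: "{g \<in> staircases k q. a < g \<and> g < b} = I - {a, b}"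
    by (auto simp: I_def order_le_less)
  have "bij_betw \<psi> {g \<in> staircases k q. a < g \<and> g < b} (Field (proper_part P))"
    unfolding open_eq
  proof (rule bij_betw_imageI)
    show "inj_on \<psi> (I - {a, b})" using eq_iff by (auto intro: inj_onI)
    show "\<psi> ` (I - {a, b}) = Field (proper_part P)"
    proof (intro equalityI subsetI)
      fix xs assume "xs \<in> \<psi> ` (I - {a, b})"
      then obtain g where g: "g \<in> I" "g \<noteq> a" "g \<noteq> b" "xs = \<psi> g" by auto
      then have "xs \<noteq> \<psi> a" "xs \<noteq> \<psi> b" using eq_iff aI bI by auto
      then show "xs \<in> Field (proper_part P)"
        unfolding P_def Field_proper_part_prod_of_chains using len \<psi>_le g \<psi>a ms_def by auto
    next
      fix xs assume "xs \<in> Field (proper_part P)"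
      then have xs: "length xs = length ms" "\<forall>i<length ms. xs ! i \<le> ms ! i" "xs \<noteq> \<psi> a" "xs \<noteq> \<psi> b"
        unfolding P_def Field_proper_part_prod_of_chains \<psi>a ms_def[symmetric] by auto
      then show "xs \<in> \<psi> ` (I - {a, b})" using surj[OF xs(1,2)] by blast
    qed
  qed
  moreover have "(\<psi> g, \<psi> h) \<in> proper_part P \<longleftrightarrow> g \<le> h"
    if "g \<in> staircases k q" "a < g" "g < b" "h \<in> staircases k q" "a < h" "h < b" for g h
  proof -
    have I: "g \<in> I" "h \<in> I" using that by (auto simp: I_def)
    have "\<psi> g \<noteq> \<psi> a" "\<psi> g \<noteq> \<psi> b" "\<psi> h \<noteq> \<psi> a" "\<psi> h \<noteq> \<psi> b"
      using eq_iff[OF I(1) aI] eq_iff[OF I(1) bI] eq_iff[OF I(2) aI] eq_iff[OF I(2) bI] that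
      by auto
    then show ?thesis
      unfolding P_def mem_proper_part_prod_of_chains_iff mem_prod_of_chains_iff
        le_iff[OF I] \<psi>a[symmetric] ms_def[symmetric]
      using \<psi>_le[OF I(2)] len[of g] len[of h] by blast
  qed
  ultimately show ?thesis using that by blast
qed

section \<open>Links\<close>

text \<open>Rank each element by how many elements of \<open>A\<close> lie below it. Comparability
  makes the rank injective with all values below \<open>card A\<close>, so its inverse is the
  enumeration.\<close>

lemma finite_chain_enumeration:
  fixes A :: "'a :: order set"
  assumes fin: "finite A" and chain: "\<And>x y. \<lbrakk>x \<in> A; y \<in> A\<rbrakk> \<Longrightarrow> x \<le> y \<or> y \<le> x"
  obtains u where "u ` {..<card A} = A" "\<And>i j. \<lbrakk>i < j; j < card A\<rbrakk> \<Longrightarrow> u i < u j"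
proof -
  define rank where "rank x = card {y \<in> A. y < x}" for x
  have rank_less: "rank x < rank y" if "x \<in> A" "x < y" for x y
    unfolding rank_def by (rule psubset_card_mono) (use fin that in \<open>auto intro: less_trans\<close>)
  have inj: "inj_on rank A"
  proof (rule inj_onI, rule ccontr)
    fix x y assume xy: "x \<in> A" "y \<in> A" "rank x = rank y" "x \<noteq> y"
    then have "x < y \<or> y < x" using chain[OF xy(1,2)] by auto
    then show False using rank_less xy by (metis less_irrefl)
  qed
  have "rank x < card A" if "x \<in> A" for x
    unfolding rank_def by (rule psubset_card_mono) (use fin that in auto)
  then have surj: "rank ` A = {..<card A}"
    using card_image[OF inj] by (intro card_subset_eq) auto
  define u where "u = inv_into A rank"
  have u: "u i \<in> A" "rank (u i) = i" if "i < card A" for i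
    using that surj unfolding u_def by (auto intro: inv_into_into f_inv_into_f)
  have "u ` {..<card A} = A"
  proof (intro equalityI subsetI)
    fix x assume "x \<in> A"
    then have "x = u (rank x)" "rank x < card A" using inj surj by (auto simp: u_def)
    then show "x \<in> u ` {..<card A}" by blast
  qed (use u in auto)
  moreover have "u i < u j" if "i < j" "j < card A" for i j
  proof -
    have "\<not> u j < u i" using rank_less[of "u j" "u i"] u[of i] u[of j] that by auto
    moreover have "u i \<noteq> u j" using u(2)[of i] u(2)[of j] that by auto
    ultimately show ?thesis using chain[of "u i" "u j"] u[of i] u[of j] that by auto
  qed
  ultimately show ?thesis using that by blast
qed

definition near :: "nat \<Rightarrow> (nat \<Rightarrow> real) \<Rightarrow> (nat \<Rightarrow> real) \<Rightarrow> bool" where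
  "near k x y \<longleftrightarrow> below_within_one k x y \<or> below_within_one k y x"

lemma near_refl: "near k x x"
  by (simp add: near_def below_within_one_def)

lemma near_sym: "near k x y \<longleftrightarrow> near k y x"
  by (auto simp: near_def)

text \<open>Being a face is a condition on pairs, and the pairs of the union lie in
  \<open>F\<close>, across, or in \<tau>. As \<open>F\<close> is nonempty, \<open>mem_T_iff\<close>
  applies to the union even for empty \<tau>.\<close>

lemma link_T_eq_flag:
  assumes "k \<ge> 1" "q \<ge> 1" "F \<in> T k q" "F \<noteq> {}"
  shows "link (T k q) F = flag_complex {w \<in> W k q - F. \<forall>x\<in>F. near k x w} (near k)"
proof (intro equalityI subsetI)
  have F: "F \<subseteq> W k q" "\<forall>x\<in>F. \<forall>y\<in>F. near k x y"
    using mem_T_iff[OF assms(1,2,4)] assms(3) by (auto simp: near_def)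
  fix \<tau>
  have mem: "F \<union> \<tau> \<in> T k q \<longleftrightarrow> F \<union> \<tau> \<subseteq> W k q \<and> (\<forall>x\<in>F \<union> \<tau>. \<forall>y\<in>F \<union> \<tau>. near k x y)"
    using mem_T_iff[OF assms(1,2), of "F \<union> \<tau>"] assms(4) by (simp add: near_def)
  {
    assume "\<tau> \<in> link (T k q) F"
    then have \<tau>: "F \<union> \<tau> \<in> T k q" "F \<inter> \<tau> = {}" by (auto simp: link_def)
    then have "finite \<tau>" using mem finite_W finite_subset by (metis le_sup_iff)
    then show "\<tau> \<in> flag_complex {w \<in> W k q - F. \<forall>x\<in>F. near k x w} (near k)"
      using \<tau> mem by (auto simp: flag_complex_def)
  next
    assume "\<tau> \<in> flag_complex {w \<in> W k q - F. \<forall>x\<in>F. near k x w} (near k)"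
    then have \<tau>: "\<tau> \<subseteq> W k q - F" "\<forall>x\<in>F. \<forall>y\<in>\<tau>. near k x y" "\<forall>x\<in>\<tau>. \<forall>y\<in>\<tau>. near k x y"
      by (auto simp: flag_complex_def)
    then have "\<forall>x\<in>F \<union> \<tau>. \<forall>y\<in>F \<union> \<tau>. near k x y" using F near_sym by blast
    then have FT: "F \<union> \<tau> \<in> T k q" unfolding mem using F \<tau> by blast
    then have "\<tau> \<in> T k q" unfolding T_def by blast
    then show "\<tau> \<in> link (T k q) F" using FT \<tau> by (auto simp: link_def)
  }
qed

lemma near_iff_counting:
  assumes "x \<in> W k q" "y \<in> W k q" "k \<ge> 1" "q \<ge> 1"
  shows "near k x y \<longleftrightarrow>
    counting k q y \<le> counting k q x \<and> counting k q x \<le> shift (counting k q y) \<or>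
    counting k q x \<le> counting k q y \<and> counting k q y \<le> shift (counting k q x)"
  using below_within_one_iff_counting[OF assms] below_within_one_iff_counting[OF assms(2,1,3,4)]
  by (simp add: near_def)

text \<open>If both lifts are conjugates or both are shifted, the window from \<open>a\<close> to
  \<open>shift a\<close> supplies the shift bounds of nearness, and comparability is left. If
  exactly one is shifted, the window orders the two conjugates, and the remaining shift bound is
  comparability of the lifts.\<close>

lemma near_iff_lifts_comparable:
  assumes xy: "x \<in> W k q" "y \<in> W k q" and kq: "k \<ge> 1" "q \<ge> 1"
    and g: "g = counting k q x \<or> g = shift (counting k q x)" "a \<le> g" "g \<le> shift a"
    and h: "h = counting k q y \<or> h = shift (counting k q y)" "a \<le> h" "h \<le> shift a"
  shows "near k x y \<longleftrightarrow> g \<le> h \<or> h \<le> g"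
proof -
  have crossing: "near k x y \<longleftrightarrow> counting k q x \<le> shift (counting k q y) \<or>
      shift (counting k q y) \<le> counting k q x"
    if "x \<in> W k q" "y \<in> W k q" "a \<le> counting k q x" "shift (counting k q y) \<le> shift a" for x y
  proof -
    \<comment> \<open>At -1 a shifted conjugate is nonnegative and a conjugate is negative, so only
      one of the two comparabilities can occur.\<close>
    have "shift (counting k q y) (-1) > counting k q x (-1)"
      using counting_normalized[OF kq, of x] counting_normalized[OF kq, of y] by (simp add: shift_def)
    then have "\<not> shift (counting k q y) \<le> counting k q x" by (auto simp: le_fun_def not_le)
    moreover have "counting k q y \<le> counting k q x"
      using that(3,4) order_trans shift_le_shift_iff by blast
    ultimately show ?thesis using near_iff_counting[OF that(1,2) kq] by (auto dest: order_antisym)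
  qed
  have sh: "c \<le> shift d" if "c \<le> shift a" "a \<le> d" for c d
    using that shift_le_shift_iff[of a d] by (metis order_trans)
  consider "g = counting k q x" "h = counting k q y"
    | "g = counting k q x" "h = shift (counting k q y)"
    | "g = shift (counting k q x)" "h = counting k q y"
    | "g = shift (counting k q x)" "h = shift (counting k q y)" using g h by blast
  then show ?thesis
  proof cases
    case 1
    then have "counting k q x \<le> shift (counting k q y)" "counting k q y \<le> shift (counting k q x)"
      using sh g h by auto
    then show ?thesis using near_iff_counting[OF xy kq] 1 by auto
  next
    case 2
    then show ?thesis using crossing[OF xy] g h by simp
  next
    case 3
    then show ?thesis using crossing[OF xy(2,1)] g h near_sym by blast
  next
    case 4
    then have "counting k q x \<le> shift (counting k q y)" "counting k q y \<le> shift (counting k q x)"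
      using g h by (auto intro: order_trans)
    then show ?thesis using near_iff_counting[OF xy kq] 4 by auto
  qed
qed

theorem mainTheorem6:
  fixes k q t :: nat and F :: "(nat \<Rightarrow> real) set"
  assumes "k \<ge> 2" and "q \<ge> 1"
    and "F \<in> T k q" and "t \<ge> 1" and "card F = t"
  shows "\<exists>P :: nat list rel list. length P = t \<and> (\<forall>r \<in> set P. product_of_chains r) \<and>
    link (T k q) F \<cong>\<^sub>c complex_join (map (\<lambda>r. order_complex (proper_part r)) P)"
proof -
  let ?G = "counting k q"
  have kq: "k \<ge> 1" "q \<ge> 1" using assms by auto
  have F_ne: "F \<noteq> {}" and finF: "finite F" using assms card_gt_0_iff[of F] by auto
  have FW: "F \<subseteq> W k q" and F_near: "\<And>x y. \<lbrakk>x \<in> F; y \<in> F\<rbrakk> \<Longrightarrow> near k x y"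
    using mem_T_iff[OF kq F_ne] assms(3) by (auto simp: near_def)
  have G_st: "?G w \<in> staircases k q" for w by (rule counting_in_staircases[OF kq])
  have G_inj: "inj_on ?G (W k q)" using counting_inj[OF _ _ kq] by (auto intro: inj_onI)
  have G_ne_shift: "?G x \<noteq> shift (?G y)" for x y
  proof
    assume "?G x = shift (?G y)"
    then have "?G x (-1) = ?G y 0" by (simp add: shift_def)
    then show False using counting_normalized[OF kq, of x] counting_normalized[OF kq, of y] by simp
  qed
  \<comment> \<open>The shift bound holds both ways: nearness gives it for the larger function,
    \<open>le_shift\<close> for the smaller.\<close>
  have F_between: "(?G x \<le> ?G y \<or> ?G y \<le> ?G x) \<and> ?G x \<le> shift (?G y)" if "x \<in> F" "y \<in> F" for x y
  proof -
    have "x \<in> W k q" "y \<in> W k q" using FW that by auto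
    then show ?thesis
      using F_near[OF that] le_shift[OF G_st[of y]] near_iff_counting[of x k q y, OF _ _ kq]
      by (auto intro: order_trans)
  qed

  \<comment> \<open>The face as an increasing chain closed up by the shift\<close>
  have card_GF: "card (?G ` F) = t"
    using card_image[OF inj_on_subset[OF G_inj FW]] assms(5) by simp
  obtain u where u: "u ` {..<card (?G ` F)} = ?G ` F" "\<And>i j. \<lbrakk>i < j; j < card (?G ` F)\<rbrakk> \<Longrightarrow> u i < u j"
    by (rule finite_chain_enumeration[of "?G ` F"]) (use finF F_between in auto)
  note u = u[unfolded card_GF]
  define v where "v i = (if i < t then u i else shift (u 0))" for i
  have v_img: "v ` {..<t} = ?G ` F" using u(1) by (auto simp: v_def)
  have v_G: "\<exists>x\<in>F. v i = ?G x" if "i < t" for i using that v_img by blast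
  have v_t: "v t = shift (v 0)" using assms(4) by (simp add: v_def)
  have v_st: "v i \<in> staircases k q" if "i \<le> t" for i
    using that v_G[of i] v_G[of 0] v_t G_st shift_in_staircases assms(4)
    by (cases "i = t") fastforce+
  have v_less: "v i < v j" if "i < j" "j \<le> t" for i j
  proof (cases "j = t")
    case True
    then have "i < t" "0 < t" using that by auto
    then obtain x y where "x \<in> F" "y \<in> F" "v i = ?G x" "v 0 = ?G y"
      using v_G by metis
    then show ?thesis unfolding True v_t using F_between G_ne_shift by (auto simp: less_le)
  next
    case False
    then show ?thesis using that u(2) by (simp add: v_def)
  qed
  have v_le: "v i \<le> v j" if "i \<le> j" "j \<le> t" for i j
    using that v_less[of i j] by (cases "i = j") auto
  \<comment> \<open>Names the outcome of \<open>staircase_interval_iso_product\<close>, so that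
    poset and bijection can be chosen together for all i < t.\<close>
  define Q where "Q i P \<psi> \<longleftrightarrow> product_of_chains P \<and>
    bij_betw \<psi> {g \<in> staircases k q. v i < g \<and> g < v (Suc i)} (Field (proper_part P)) \<and>
    (\<forall>g h. g \<in> staircases k q \<and> v i < g \<and> g < v (Suc i) \<and> h \<in> staircases k q \<and> v i < h \<and> h < v (Suc i)
       \<longrightarrow> ((\<psi> g, \<psi> h) \<in> proper_part P \<longleftrightarrow> g \<le> h))" for i P and \<psi> :: "(int \<Rightarrow> int) \<Rightarrow> nat list"
  have "\<exists>P \<psi>. Q i P \<psi>" if i: "i < t" for i
  proof -
    have "v (Suc i) \<le> v t" using v_le i by simp
    also have "\<dots> \<le> shift (v i)" using v_le[of 0 i] i by (simp add: v_t)
    finally have le: "v (Suc i) \<le> shift (v i)" .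
    have ends: "v i \<in> staircases k q" "v (Suc i) \<in> staircases k q" "v i < v (Suc i)"
      using v_st[of i] v_st[of "Suc i"] v_less[of i "Suc i"] i by simp_all
    show ?thesis
    proof (rule staircase_interval_iso_product[OF kq(2) ends le])
      fix P \<psi>
      assume "product_of_chains P"
        "bij_betw \<psi> {g \<in> staircases k q. v i < g \<and> g < v (Suc i)} (Field (proper_part P))"
        "\<And>g h. \<lbrakk>g \<in> staircases k q; v i < g; g < v (Suc i); h \<in> staircases k q; v i < h; h < v (Suc i)\<rbrakk> \<Longrightarrow>
          (\<psi> g, \<psi> h) \<in> proper_part P \<longleftrightarrow> g \<le> h"
      then have "Q i P \<psi>" by (simp add: Q_def)
      then show ?thesis by blast
    qed
  qed
  then obtain P \<psi> where Q: "\<And>i. i < t \<Longrightarrow> Q i (P i) (\<psi> i)" by metis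

  \<comment> \<open>The open intervals between consecutive members of the chain\<close>
  define I where "I i = {g \<in> staircases k q. v i < g \<and> g < v (Suc i)}" for i
  have P_prod: "product_of_chains (P i)" if "i < t" for i using Q[OF that] by (simp add: Q_def)
  have \<psi>_bij: "bij_betw (\<psi> i) (I i) (Field (proper_part (P i)))" if "i < t" for i
    using Q[OF that] by (simp add: Q_def I_def)
  have \<psi>_iff: "(\<psi> i g, \<psi> i h) \<in> proper_part (P i) \<longleftrightarrow> g \<le> h" if "i < t" "g \<in> I i" "h \<in> I i" for i g h
    using Q[OF that(1)] that by (simp add: Q_def I_def)
  have I_less: "g < h" if "g \<in> I i" "h \<in> I j" "i < j" "j < t" for g h i j
  proof -
    have "g < v (Suc i)" "v (Suc i) \<le> v j" "v j < h" using that v_le[of "Suc i" j] by (auto simp: I_def)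
    then show ?thesis by order
  qed
  have I_v: "g \<noteq> v j \<and> (g \<le> v j \<or> v j \<le> g)" if "g \<in> I i" "i < t" "j \<le> t" for g i j
  proof (cases "j \<le> i")
    case True
    then have "v j \<le> v i" "v i < g" using that v_le by (auto simp: I_def)
    then show ?thesis by auto
  next
    case False
    then have "v (Suc i) \<le> v j" "g < v (Suc i)" using that v_le by (auto simp: I_def)
    then show ?thesis by auto
  qed
  have I_bounds: "v 0 < g \<and> g < v t" if "g \<in> I i" "i < t" for g i
  proof -
    have "v 0 \<le> v i" "v i < g" "g < v (Suc i)" "v (Suc i) \<le> v t" using that v_le by (auto simp: I_def)
    then show ?thesis by (intro conjI) order+
  qed
  have I_ex: "\<exists>i<t. g \<in> I i" if g: "g \<in> staircases k q" "v 0 < g" "g < v t"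
    "\<And>i. i < t \<Longrightarrow> g \<noteq> v i \<and> (g \<le> v i \<or> v i \<le> g)" for g
  proof -
    \<comment> \<open>The last member of the chain below \<open>g\<close>. The next one is
      comparable with \<open>g\<close>, different from it and not below it; for
      \<open>Suc i = t\<close> the bound \<open>g < v t\<close> takes over.\<close>
    define i where "i = Max {i. i < t \<and> v i < g}"
    have fin: "finite {i. i < t \<and> v i < g}" by simp
    have "0 \<in> {i. i < t \<and> v i < g}" using g assms(4) by simp
    then have "i \<in> {i. i < t \<and> v i < g}" unfolding i_def by (intro Max_in[OF fin]) blast
    then have i: "i < t" "v i < g" by auto
    have "\<not> (Suc i < t \<and> v (Suc i) < g)" using Max_ge[OF fin, of "Suc i", folded i_def] by auto
    then have "g < v (Suc i)" using g(3) g(4)[of "Suc i"] i(1) by (cases "Suc i = t") auto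
    then show ?thesis using g(1) i by (auto simp: I_def)
  qed

  \<comment> \<open>Lifting the vertices of the link into the intervals\<close>
  define U where "U = (\<Union>i<t. I i)"
  define L where "L = {w \<in> W k q - F. \<forall>x\<in>F. near k x w}"
  \<comment> \<open>If the conjugate is not above \<open>v 0\<close>, nearness to the vertex with
    conjugate \<open>v 0\<close> puts it below \<open>v 0\<close> and its shift above.\<close>
  define \<phi> where "\<phi> w = (if v 0 \<le> ?G w then ?G w else shift (?G w))" for w
  obtain x0 where x0: "x0 \<in> F" "v 0 = ?G x0" using v_G[of 0] assms(4) by auto
  have \<phi>_lift: "\<phi> w = ?G w \<or> \<phi> w = shift (?G w)" for w by (simp add: \<phi>_def)
  have \<phi>_st: "\<phi> w \<in> staircases k q" for w using G_st shift_in_staircases by (simp add: \<phi>_def)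
  have \<phi>_box: "v 0 \<le> \<phi> w \<and> \<phi> w \<le> shift (v 0)" if "w \<in> L" for w
  proof -
    have "near k x0 w" "w \<in> W k q" "x0 \<in> W k q" using that x0 FW by (auto simp: L_def)
    then show ?thesis
      using near_iff_counting[of x0 k q w, OF _ _ kq] le_shift[OF G_st[of w]]
      by (auto simp: \<phi>_def x0(2))
  qed
  have v0_box: "v 0 \<le> v i \<and> v i \<le> shift (v 0)" if "i < t" for i
    using v_le[of 0 i] v_le[of i t] v_t that by simp
  have \<phi>_U: "\<phi> w \<in> U" if w: "w \<in> L" for w
  proof -
    have ne: "\<phi> w \<noteq> v i \<and> (\<phi> w \<le> v i \<or> v i \<le> \<phi> w)" if i: "i < t" for i
    proof -
      obtain x where x: "x \<in> F" "v i = ?G x" using v_G[OF i] by auto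
      have mem: "x \<in> W k q" "w \<in> W k q" "w \<notin> F" "near k x w" using x w FW by (auto simp: L_def)
      then have "?G w \<noteq> ?G x" using x inj_onD[OF G_inj] by metis
      then have "\<phi> w \<noteq> v i" using \<phi>_lift[of w] G_ne_shift[of x w] x by auto
      moreover have "v i \<le> \<phi> w \<or> \<phi> w \<le> v i"
        using near_iff_lifts_comparable[OF mem(1,2) kq _ _ _ \<phi>_lift, of "v i" "v 0"] mem(4) x
          v0_box[OF i] \<phi>_box[OF w] by auto
      ultimately show ?thesis by blast
    qed
    have "w \<in> W k q" "w \<notin> F" "x0 \<in> W k q" using w x0 FW by (auto simp: L_def)
    then have "?G w \<noteq> ?G x0" using x0 inj_onD[OF G_inj] by metis
    then have "\<phi> w \<noteq> v t" using \<phi>_lift[of w] G_ne_shift[of w x0] by (auto simp: v_t x0)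
    then have "\<phi> w < v t" using \<phi>_box[OF w] v_t by (simp add: less_le)
    moreover have "\<phi> w \<noteq> v 0" using ne assms(4) by simp
    then have "v 0 < \<phi> w" using \<phi>_box[OF w] by auto
    ultimately have "\<exists>i<t. \<phi> w \<in> I i" using ne \<phi>_st by (intro I_ex) blast+
    then show ?thesis by (auto simp: U_def)
  qed
  have \<phi>_surj: "\<exists>w\<in>L. \<phi> w = g" if gU: "g \<in> U" for g
  proof -
    obtain i where i: "i < t" "g \<in> I i" using gU by (auto simp: U_def)
    have g: "g \<in> staircases k q" "v 0 < g" "g < shift (v 0)"
      using i I_bounds[OF i(2,1)] by (auto simp: I_def v_t)
    have g_le: "v 0 c \<le> g c" "g c \<le> v 0 (c + 1)" for c
      using g by (auto simp: less_fun_def le_fun_def shift_def)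
    obtain w where w: "w \<in> W k q" "g = ?G w \<or> g = shift (?G w)"
    proof (cases "g (-1) < 0")
      case True
      moreover have "0 \<le> g 0" using g_le(1)[of 0] counting_normalized(2)[OF kq, of x0] by (simp add: x0)
      ultimately show ?thesis using counting_surj[OF g(1) _ _ kq] that by metis
    next
      case False
      \<comment> \<open>When \<open>g\<close> is nonnegative at -1, one step back normalizes it,
        because g (-2) \<le> v 0 (-1) < 0.\<close>
      define h where "h c = g (c - 1)" for c
      have "shift h = g" by (simp add: h_def shift_def)
      moreover have "h \<in> staircases k q"
        using g(1) unfolding staircases_def h_def mono_def by (auto simp: algebra_simps)
          (metis add_diff_eq diff_add_eq)
      moreover have "h (-1) < 0"
        using g_le(2)[of "-2"] counting_normalized(1)[OF kq, of x0] by (simp add: x0 h_def)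
      moreover have "0 \<le> h 0" using False by (simp add: h_def)
      ultimately show ?thesis using counting_surj[of h, OF _ _ _ kq] that by metis
    qed
    have \<phi>w: "\<phi> w = g"
    proof (cases "g = ?G w")
      case True
      then show ?thesis using less_imp_le[OF g(2)] by (simp add: \<phi>_def)
    next
      case False
      then have "g = shift (?G w)" using w by simp
      moreover from this have "\<not> v 0 \<le> ?G w" using g(3)
        by (simp add: less_le_not_le)
      ultimately show ?thesis by (simp add: \<phi>_def)
    qed
    have "near k x w" if x: "x \<in> F" for x
    proof -
      obtain j where j: "j < t" "v j = ?G x" using x v_img by (metis image_iff lessThan_iff)
      show ?thesis
        using near_iff_lifts_comparable[of x k q w "v j" "v 0" g, OF _ w(1) kq _ _ _ w(2)]
          I_v[OF i(2,1), of j] v0_box[OF j(1)] g FW x j by auto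
    qed
    \<comment> \<open>A member of \<open>F\<close> would make \<open>g\<close> equal to some
      \<open>v j\<close>, which no open interval contains, or to \<open>shift (v j)\<close>, which
      is not below \<open>shift (v 0)\<close>.\<close>
    moreover have "w \<notin> F"
    proof
      assume "w \<in> F"
      then obtain j where j: "j < t" "v j = ?G w" using v_img by (metis image_iff lessThan_iff)
      have "g \<noteq> v j" using I_v[OF i(2,1), of j] j by simp
      then have "g = shift (v j)" using w j by simp
      then have "shift (v 0) \<le> g" using v0_box[OF j(1)] by simp
      then show False using g(3) by (simp add: less_le_not_le)
    qed
    ultimately show ?thesis using \<phi>w w(1) by (auto simp: L_def)
  qed
  have near_iff: "near k x y \<longleftrightarrow> \<phi> x \<le> \<phi> y \<or> \<phi> y \<le> \<phi> x" if "x \<in> L" "y \<in> L" for x y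
    using near_iff_lifts_comparable[OF _ _ kq \<phi>_lift _ _ \<phi>_lift] that \<phi>_box by (auto simp: L_def)
  have \<phi>_bij: "bij_betw \<phi> L U"
  proof (rule bij_betw_imageI)
    show "inj_on \<phi> L"
    proof (rule inj_onI)
      fix x y assume xy: "x \<in> L" "y \<in> L" "\<phi> x = \<phi> y"
      then have "?G x = ?G y"
        using \<phi>_lift[of x] \<phi>_lift[of y] G_ne_shift[of x y] G_ne_shift[of y x] by auto
      then show "x = y" using inj_onD[OF G_inj] xy by (auto simp: L_def)
    qed
    show "\<phi> ` L = U" using \<phi>_U \<phi>_surj by blast
  qed

  \<comment> \<open>Matching the union of the intervals with the vertices of the join\<close>
  define idx where "idx g = (THE i. i < t \<and> g \<in> I i)" for g
  have idx: "idx g = i" if "i < t" "g \<in> I i" for g i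
    unfolding idx_def
  proof (rule the_equality)
    fix j assume "j < t \<and> g \<in> I j"
    then show "j = i" using that I_less[of g i g j] I_less[of g j g i] by (cases i j rule: linorder_cases) auto
  qed (use that in simp)
  define \<theta> where "\<theta> g = (idx g, \<psi> (idx g) g)" for g
  let ?V = "SIGMA i:{..<t}. Field (proper_part (P i))"
  let ?r = "\<lambda>i x y. (x, y) \<in> proper_part (P i) \<or> (y, x) \<in> proper_part (P i)"
  have \<theta>_bij: "bij_betw \<theta> U ?V"
  proof (rule bij_betw_imageI)
    show "inj_on \<theta> U"
    proof (rule inj_onI)
      fix g h assume gh: "g \<in> U" "h \<in> U" "\<theta> g = \<theta> h"
      then obtain i j where ij: "i < t" "g \<in> I i" "j < t" "h \<in> I j" by (auto simp: U_def)
      then have "i = j" "\<psi> i g = \<psi> i h" using gh(3) idx by (auto simp: \<theta>_def)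
      then show "g = h" using bij_betw_imp_inj_on[OF \<psi>_bij[OF ij(1)]] ij by (auto dest: inj_onD)
    qed
    show "\<theta> ` U = ?V"
    proof (intro equalityI subsetI)
      fix z assume "z \<in> \<theta> ` U"
      then obtain g i where "i < t" "g \<in> I i" "z = \<theta> g" by (auto simp: U_def)
      then show "z \<in> ?V" using idx bij_betw_apply[OF \<psi>_bij] by (auto simp: \<theta>_def)
    next
      fix z assume "z \<in> ?V"
      then obtain i x where z: "z = (i, x)" "i < t" "x \<in> Field (proper_part (P i))" by auto
      then obtain g where "g \<in> I i" "x = \<psi> i g"
        using bij_betw_imp_surj_on[OF \<psi>_bij[OF z(2)]] by auto
      then show "z \<in> \<theta> ` U" using z idx[OF z(2)] by (auto simp: \<theta>_def U_def intro!: image_eqI[of _ _ g])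
    qed
  qed
  have \<theta>_iff: "(g \<le> h \<or> h \<le> g) \<longleftrightarrow> (\<lambda>(i, x) (j, y). i = j \<longrightarrow> ?r i x y) (\<theta> g) (\<theta> h)"
    if gh: "g \<in> U" "h \<in> U" for g h
  proof -
    obtain i j where ij: "i < t" "g \<in> I i" "j < t" "h \<in> I j" using gh by (auto simp: U_def)
    have \<theta>: "\<theta> g = (i, \<psi> i g)" "\<theta> h = (j, \<psi> j h)" using ij idx by (simp_all add: \<theta>_def)
    show ?thesis
    proof (cases "i = j")
      case True
      then show ?thesis using \<psi>_iff[OF ij(1,2), of h] \<psi>_iff[OF ij(1) _ ij(2), of h] ij(4) by (simp add: \<theta>)
    next
      case False
      \<comment> \<open>The join structure comes from here: functions in different intervals are
        always comparable, just as vertices of different factors are always joined.\<close>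
      then have "g < h \<or> h < g"
        using I_less[OF ij(2,4) _ ij(3)] I_less[OF ij(4,2) _ ij(1)] by linarith
      then show ?thesis using False by (auto simp: \<theta>)
    qed
  qed
  have "flag_complex L (near k) \<cong>\<^sub>c flag_complex ?V (\<lambda>(i, x) (j, y). i = j \<longrightarrow> ?r i x y)"
  proof (rule flag_complex_iso[OF bij_betw_trans[OF \<phi>_bij \<theta>_bij]])
    fix x y assume xy: "x \<in> L" "y \<in> L"
    show "near k x y \<longleftrightarrow> (\<lambda>(i, x) (j, y). i = j \<longrightarrow> ?r i x y) ((\<theta> \<circ> \<phi>) x) ((\<theta> \<circ> \<phi>) y)"
      unfolding near_iff[OF xy] \<theta>_iff[OF \<phi>_U[OF xy(1)] \<phi>_U[OF xy(2)]] o_def ..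
  qed (rule near_refl)
  moreover have "link (T k q) F = flag_complex L (near k)"
    unfolding L_def by (rule link_T_eq_flag[OF kq assms(3) F_ne])
  moreover have "flag_complex ?V (\<lambda>(i, x) (j, y). i = j \<longrightarrow> ?r i x y) =
      complex_join (map (\<lambda>r. order_complex (proper_part r)) (map P [0..<t]))"
    unfolding complex_join_flag[symmetric] order_complex_eq_flag by (simp add: o_def)
  ultimately show ?thesis using P_prod by (intro exI[of _ "map P [0..<t]"]) auto
qed

end
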